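(* There exists an infinite, connected, locally finite graph $H$ such that for every vertex $u\in V(H)$ and every integer $r\ge 1$ the ball $H_r(u)$ of radius $r$ centered at $u$ is Hamiltonian, but $H$ has no Hamilton circle.
   Context: Graphs have no loops or multiple edges. A graph is locally finite if every vertex has finite degree. For a vertex $u$ of a graph $H$ and an integer $r\ge 0$, the ball $H_r(u)$ of radius $r$ centered at $u$ is the subgraph of $H$ induced by the set of vertices at distance at most $r$ from $u$ in $H$. A finite graph is Hamiltonian if it has a cycle (of length at least $3$) containing all its vertices. A ray is a one-way infinite path. Two rays of $H$ are equivalent if for every finite $S\subset V(H)$ both have a tail in the same component of $H-S$; the equivalence classes are the ends of $H$. $|H|$ denotes the Freudenthal compactification of $H$: the topological space obtained from $H$, viewed as a 1-complex, by adding the ends of $H$ as additional points, with the standard topology (every ray converges to the end containing it). A circle in $|H|$ is a homeomorphic image of the unit circle $S^1$ in $|H|$ (i.e. a subspace of $|H|$ homeomorphic to $S^1$). A Hamilton circle of $H$ is a circle in $|H|$ containing all vertices and all ends of $H$. *)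

theory Defs
  imports "HOL-Analysis.Analysis" "HOL-Library.Extended_Nat"
begin

text \<open>
  A graph is given by its vertex set \<open>V\<close> and its adjacency relation \<open>E\<close>; an undirected
  edge \<open>uv\<close> is the pair of ordered pairs \<open>(u, v)\<close>, \<open>(v, u)\<close>.
\<close>

definition simple_graph :: "'a set \<Rightarrow> 'a rel \<Rightarrow> bool" where
  "simple_graph V E \<longleftrightarrow> E \<subseteq> V \<times> V \<and> sym E \<and> irrefl E"

definition graph_connected :: "'a set \<Rightarrow> 'a rel \<Rightarrow> bool" where
  "graph_connected V E \<longleftrightarrow> (\<forall>u\<in>V. \<forall>v\<in>V. (u, v) \<in> E\<^sup>*)"

definition locally_finite :: "'a set \<Rightarrow> 'a rel \<Rightarrow> bool" where
  "locally_finite V E \<longleftrightarrow> (\<forall>u\<in>V. finite (E `` {u}))"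

definition induced_edges :: "'a rel \<Rightarrow> 'a set \<Rightarrow> 'a rel" where
  "induced_edges E W = E \<inter> W \<times> W"

text \<open>Vertices in different components have distance \<open>\<infinity>\<close>, the infimum of the empty set.\<close>

definition graph_dist :: "'a rel \<Rightarrow> 'a \<Rightarrow> 'a \<Rightarrow> enat" where
  "graph_dist E u v = (INF n \<in> {n. (u, v) \<in> E ^^ n}. enat n)"

definition ball_verts :: "'a set \<Rightarrow> 'a rel \<Rightarrow> 'a \<Rightarrow> nat \<Rightarrow> 'a set" where
  "ball_verts V E u r = {v \<in> V. graph_dist E u v \<le> enat r}"

definition is_cycle :: "'a rel \<Rightarrow> 'a list \<Rightarrow> bool" where
  "is_cycle E c \<longleftrightarrow> length c \<ge> 3 \<and> distinct c \<and>
     (\<forall>i < length c. (c ! i, c ! (Suc i mod length c)) \<in> E)"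

definition hamiltonian :: "'a set \<Rightarrow> 'a rel \<Rightarrow> bool" where
  "hamiltonian V E \<longleftrightarrow> finite V \<and> (\<exists>c. is_cycle E c \<and> set c = V)"

definition graph_components :: "'a set \<Rightarrow> 'a rel \<Rightarrow> 'a set set" where
  "graph_components V E = (\<lambda>u. E\<^sup>* `` {u}) ` V"

abbreviation components_minus :: "'a set \<Rightarrow> 'a rel \<Rightarrow> 'a set \<Rightarrow> 'a set set" where
  "components_minus V E S \<equiv> graph_components (V - S) (induced_edges E (V - S))"


section \<open>Ends\<close>

definition rays :: "'a set \<Rightarrow> 'a rel \<Rightarrow> (nat \<Rightarrow> 'a) set" where
  "rays V E = {\<rho>. inj \<rho> \<and> range \<rho> \<subseteq> V \<and> (\<forall>n. (\<rho> n, \<rho> (Suc n)) \<in> E)}"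

definition has_tail_in :: "(nat \<Rightarrow> 'a) \<Rightarrow> 'a set \<Rightarrow> bool" where
  "has_tail_in \<rho> C \<longleftrightarrow> (\<exists>n. \<rho> ` {n..} \<subseteq> C)"

definition ray_equiv :: "'a set \<Rightarrow> 'a rel \<Rightarrow> (nat \<Rightarrow> 'a) rel" where
  "ray_equiv V E = {(\<rho>, \<sigma>). \<rho> \<in> rays V E \<and> \<sigma> \<in> rays V E \<and>
     (\<forall>S. finite S \<and> S \<subseteq> V \<longrightarrow>
        (\<exists>C \<in> components_minus V E S. has_tail_in \<rho> C \<and> has_tail_in \<sigma> C))}"

definition graph_ends :: "'a set \<Rightarrow> 'a rel \<Rightarrow> (nat \<Rightarrow> 'a) set set" where
  "graph_ends V E = rays V E // ray_equiv V E"

text \<open>For a component \<open>C\<close> of \<open>H - S\<close> with \<open>S\<close> finite, this says that \<open>C = C(S, \<omega>)\<close>.\<close>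

definition end_lives_in :: "(nat \<Rightarrow> 'a) set \<Rightarrow> 'a set \<Rightarrow> bool" where
  "end_lives_in \<omega> C \<longleftrightarrow> (\<forall>\<rho> \<in> \<omega>. has_tail_in \<rho> C)"


section \<open>The Freudenthal compactification\<close>

text \<open>
  A point of the 1-complex is represented by its barycentric coordinates, a function from
  vertices to reals. Thus \<open>edge_point u v t = edge_point v u (1 - t)\<close>, the two ends of
  an edge are \<open>vertex_point u\<close> and \<open>vertex_point v\<close>, and different edges have disjoint
  interiors.
\<close>

definition vertex_point :: "'a \<Rightarrow> 'a \<Rightarrow> real" where
  "vertex_point u = indicator {u}"

definition edge_point :: "'a \<Rightarrow> 'a \<Rightarrow> real \<Rightarrow> 'a \<Rightarrow> real" where
  "edge_point u v t = (\<lambda>w. (1 - t) * vertex_point u w + t * vertex_point v w)"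

definition one_complex :: "'a set \<Rightarrow> 'a rel \<Rightarrow> ('a \<Rightarrow> real) set" where
  "one_complex V E = vertex_point ` V \<union> {edge_point u v t | u v t. (u, v) \<in> E \<and> 0 \<le> t \<and> t \<le> 1}"

datatype 'a fpoint = Pt "'a \<Rightarrow> real" | End "(nat \<Rightarrow> 'a) set"

definition freudenthal_points :: "'a set \<Rightarrow> 'a rel \<Rightarrow> 'a fpoint set" where
  "freudenthal_points V E = Pt ` one_complex V E \<union> End ` graph_ends V E"

text \<open>
  The basic open set \<open>C\<^sub>\<epsilon>(S, \<omega>)\<close> around an end \<open>\<omega>\<close>, where \<open>C = C(S, \<omega>)\<close>: the component \<open>C\<close>,
  the ends that live in \<open>C\<close>, and the inner points of \<open>S\<close>--\<open>C\<close> edges at distance less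
  than \<open>\<epsilon>\<close> from their endpoint in \<open>C\<close>.
\<close>

definition end_nbhd :: "'a set \<Rightarrow> 'a rel \<Rightarrow> 'a set \<Rightarrow> 'a set \<Rightarrow> real \<Rightarrow> 'a fpoint set" where
  "end_nbhd V E S C \<epsilon> =
     Pt ` one_complex C (induced_edges E C)
     \<union> End ` {\<omega> \<in> graph_ends V E. end_lives_in \<omega> C}
     \<union> Pt ` {edge_point y x t | y x t. y \<in> C \<and> x \<in> S \<and> (y, x) \<in> E \<and> 0 < t \<and> t < 1 \<and> t < \<epsilon>}"

text \<open>
  The first condition says that \<open>U\<close> meets the 1-complex in an open set, with respect to the
  weak (CW) topology. For locally finite graphs this agrees with the metric topology.
\<close>

definition freudenthal_open :: "'a set \<Rightarrow> 'a rel \<Rightarrow> 'a fpoint set \<Rightarrow> bool" where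
  "freudenthal_open V E U \<longleftrightarrow> U \<subseteq> freudenthal_points V E \<and>
     (\<forall>(u, v) \<in> E. openin (top_of_set {0..1}) {t \<in> {0..1}. Pt (edge_point u v t) \<in> U}) \<and>
     (\<forall>\<omega>. End \<omega> \<in> U \<longrightarrow>
        (\<exists>S C \<epsilon>. finite S \<and> S \<subseteq> V \<and> C \<in> components_minus V E S \<and> end_lives_in \<omega> C \<and>
           \<epsilon> > 0 \<and> end_nbhd V E S C \<epsilon> \<subseteq> U))"

definition freudenthal :: "'a set \<Rightarrow> 'a rel \<Rightarrow> 'a fpoint topology" where
  "freudenthal V E = topology (freudenthal_open V E)"

definition circle_in :: "'b topology \<Rightarrow> 'b set \<Rightarrow> bool" where
  "circle_in X K \<longleftrightarrow> K \<subseteq> topspace X \<and>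
     subtopology X K homeomorphic_space top_of_set (sphere (0::complex) 1)"

definition hamilton_circle :: "'a set \<Rightarrow> 'a rel \<Rightarrow> 'a fpoint set \<Rightarrow> bool" where
  "hamilton_circle V E K \<longleftrightarrow> circle_in (freudenthal V E) K \<and>
     (\<forall>v \<in> V. Pt (vertex_point v) \<in> K) \<and> (\<forall>\<omega> \<in> graph_ends V E. End \<omega> \<in> K)"


section \<open>The definitions above yield an equivalence relation and a topology\<close>

lemma sym_rtrancl_induced: "sym E \<Longrightarrow> sym ((induced_edges E W)\<^sup>*)"
  by (intro sym_rtrancl) (auto simp: induced_edges_def sym_def)

lemma component_eqI:
  assumes "sym E" "C \<in> components_minus V E S" "D \<in> components_minus V E S" "x \<in> C" "x \<in> D"
  shows "C = D"
proof -
  let ?R = "(induced_edges E (V - S))\<^sup>*"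
  have e: "equiv UNIV ?R"
    using sym_rtrancl_induced[OF assms(1)] by (intro equivI) (auto intro: refl_rtrancl trans_rtrancl)
  obtain u v where "C = ?R `` {u}" "D = ?R `` {v}"
    using assms by (auto simp: graph_components_def)
  with assms(4,5) show ?thesis
    using equiv_class_eq[OF e, of u x] equiv_class_eq[OF e, of v x] by simp
qed

lemma component_subset:
  assumes "C \<in> components_minus V E S"
  shows "C \<subseteq> V - S"
proof -
  obtain u where u: "u \<in> V - S" "C = (induced_edges E (V - S))\<^sup>* `` {u}"
    using assms by (auto simp: graph_components_def)
  have "w \<in> V - S" if "(u, w) \<in> (induced_edges E (V - S))\<^sup>*" for w
    using that u(1) by (induction rule: rtrancl_induct) (auto simp: induced_edges_def)
  with u show ?thesis by blast
qed

lemma component_closed: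
  assumes "C \<in> components_minus V E S" "y \<in> C" "(y, x) \<in> E" "x \<in> V - S"
  shows "x \<in> C"
proof -
  have "(y, x) \<in> induced_edges E (V - S)"
    using assms component_subset[OF assms(1)] by (auto simp: induced_edges_def)
  with assms show ?thesis
    by (auto simp: graph_components_def intro: rtrancl_into_rtrancl)
qed

lemma component_mono:
  assumes "sym E" "C \<in> components_minus V E S" "D \<in> components_minus V E T" "T \<subseteq> S"
    and "x \<in> C" "x \<in> D"
  shows "C \<subseteq> D"
proof
  fix w assume "w \<in> C"
  obtain u where u: "C = (induced_edges E (V - S))\<^sup>* `` {u}"
    using assms by (auto simp: graph_components_def)
  have "(x, w) \<in> (induced_edges E (V - S))\<^sup>*"
    using u \<open>w \<in> C\<close> \<open>x \<in> C\<close> sym_rtrancl_induced[OF assms(1), of "V - S"]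
    unfolding sym_def by (meson Image_singleton_iff rtrancl_trans)
  then show "w \<in> D"
  proof (induction rule: rtrancl_induct)
    case base
    show ?case by fact
  next
    case (step y z)
    then show ?case
      using component_closed[OF assms(3), of y z] assms(4) by (auto simp: induced_edges_def)
  qed
qed

lemma tails_meet:
  assumes "has_tail_in \<rho> C" "has_tail_in \<rho> D"
  shows "\<exists>x. x \<in> C \<and> x \<in> D"
proof -
  from assms obtain m n where "\<rho> ` {m..} \<subseteq> C" "\<rho> ` {n..} \<subseteq> D"
    by (auto simp: has_tail_in_def)
  then have "\<rho> (max m n) \<in> C" "\<rho> (max m n) \<in> D" by auto
  then show ?thesis by blast
qed

lemma ray_tail_component:
  assumes "\<rho> \<in> rays V E" "finite S"
  shows "\<exists>C \<in> components_minus V E S. has_tail_in \<rho> C"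
proof -
  have "finite (\<rho> -` S)"
    using assms by (auto simp: rays_def intro: finite_vimageI)
  then obtain n where n: "\<And>m. \<rho> m \<in> S \<Longrightarrow> m < n"
    by (metis finite_nat_set_iff_bounded vimageI)
  define C where "C = (induced_edges E (V - S))\<^sup>* `` {\<rho> n}"
  have out: "\<rho> m \<in> V - S" if "m \<ge> n" for m
    using n[of m] that assms by (auto simp: rays_def)
  have "\<rho> m \<in> C" if "m \<ge> n" for m
    using that
  proof (induction m rule: dec_induct)
    case base
    show ?case by (simp add: C_def)
  next
    case (step m)
    have "(\<rho> m, \<rho> (Suc m)) \<in> induced_edges E (V - S)"
      using out[of m] out[of "Suc m"] step assms by (auto simp: induced_edges_def rays_def)
    with step show ?case
      by (auto simp: C_def intro: rtrancl_into_rtrancl)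
  qed
  then have "has_tail_in \<rho> C" by (auto simp: has_tail_in_def)
  moreover have "C \<in> components_minus V E S"
    using out[of n] by (auto simp: C_def graph_components_def)
  ultimately show ?thesis by blast
qed

lemma equiv_ray_equiv:
  assumes "sym E"
  shows "equiv (rays V E) (ray_equiv V E)"
proof (rule equivI)
  show "ray_equiv V E \<subseteq> rays V E \<times> rays V E" by (auto simp: ray_equiv_def)
  show "refl_on (rays V E) (ray_equiv V E)"
    unfolding refl_on_def ray_equiv_def using ray_tail_component by fastforce
  show "sym (ray_equiv V E)" unfolding sym_def ray_equiv_def by blast
  show "trans (ray_equiv V E)"
  proof (rule transI)
    fix \<rho> \<sigma> \<tau> assume a: "(\<rho>, \<sigma>) \<in> ray_equiv V E" "(\<sigma>, \<tau>) \<in> ray_equiv V E"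
    have "\<exists>C \<in> components_minus V E S. has_tail_in \<rho> C \<and> has_tail_in \<tau> C"
      if "finite S" "S \<subseteq> V" for S
    proof -
      obtain C D where "C \<in> components_minus V E S" "has_tail_in \<rho> C" "has_tail_in \<sigma> C"
        "D \<in> components_minus V E S" "has_tail_in \<sigma> D" "has_tail_in \<tau> D"
        using a \<open>finite S\<close> \<open>S \<subseteq> V\<close> unfolding ray_equiv_def by blast
      then show ?thesis
        using component_eqI[OF assms] tails_meet by metis
    qed
    with a show "(\<rho>, \<tau>) \<in> ray_equiv V E" by (auto simp: ray_equiv_def)
  qed
qed

lemma ex1_end_component:
  assumes "sym E" "\<omega> \<in> graph_ends V E" "finite S" "S \<subseteq> V"
  shows "\<exists>!C. C \<in> components_minus V E S \<and> end_lives_in \<omega> C"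
proof -
  obtain \<rho> where \<rho>: "\<rho> \<in> rays V E" "\<omega> = ray_equiv V E `` {\<rho>}"
    using assms(2) by (auto simp: graph_ends_def quotient_def)
  have self: "\<rho> \<in> \<omega>"
    using \<rho> equiv_class_self[OF equiv_ray_equiv[OF assms(1)]] by blast
  obtain C where C: "C \<in> components_minus V E S" "has_tail_in \<rho> C"
    using ray_tail_component[OF \<rho>(1) assms(3)] by blast
  have "has_tail_in \<sigma> C" if "\<sigma> \<in> \<omega>" for \<sigma>
  proof -
    have "(\<rho>, \<sigma>) \<in> ray_equiv V E" using that \<rho> by blast
    then obtain D where "D \<in> components_minus V E S" "has_tail_in \<rho> D" "has_tail_in \<sigma> D"
      using assms(3,4) unfolding ray_equiv_def by blast
    with C show ?thesis using component_eqI[OF assms(1)] tails_meet by metis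
  qed
  then have "end_lives_in \<omega> C" by (simp add: end_lives_in_def)
  moreover have "D = C" if "D \<in> components_minus V E S" "end_lives_in \<omega> D" for D
    using that C self component_eqI[OF assms(1)] tails_meet unfolding end_lives_in_def by metis
  ultimately show ?thesis using C by blast
qed

lemma end_nbhd_mono:
  assumes "simple_graph V E" "C \<in> components_minus V E S" "D \<in> components_minus V E T"
    and "T \<subseteq> S" "S \<subseteq> V" "x \<in> C" "x \<in> D" "\<delta> \<le> \<epsilon>"
  shows "end_nbhd V E S C \<delta> \<subseteq> end_nbhd V E T D \<epsilon>"
proof -
  have sub: "C \<subseteq> D"
    using component_mono[of E C V S D T x] assms by (auto simp: simple_graph_def)
  have cc: "one_complex C (induced_edges E C) \<subseteq> one_complex D (induced_edges E D)"
    using sub unfolding one_complex_def induced_edges_def by blast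
  have ee: "end_lives_in \<omega> D" if "end_lives_in \<omega> C" for \<omega>
    using that sub unfolding end_lives_in_def has_tail_in_def by blast
  have pp: "Pt (edge_point y z t) \<in> end_nbhd V E T D \<epsilon>"
    if *: "y \<in> C" "z \<in> S" "(y, z) \<in> E" "0 < t" "t < 1" "t < \<delta>" for y z t
  proof (cases "z \<in> T")
    case True
    with * sub \<open>\<delta> \<le> \<epsilon>\<close> show ?thesis
      unfolding end_nbhd_def by (intro UnI2 imageI CollectI exI[of _ y] exI[of _ z] exI[of _ t]) auto
  next
    case False
    then have "z \<in> D"
      using component_closed[OF assms(3), of y z] * sub \<open>S \<subseteq> V\<close> by auto
    then have "(y, z) \<in> induced_edges E D"
      using * sub by (auto simp: induced_edges_def)
    then have "edge_point y z t \<in> one_complex D (induced_edges E D)"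
      using * unfolding one_complex_def by force
    then show ?thesis by (auto simp: end_nbhd_def)
  qed
  show ?thesis
  proof
    fix p assume "p \<in> end_nbhd V E S C \<delta>"
    then consider "p \<in> Pt ` one_complex C (induced_edges E C)"
      | "p \<in> End ` {\<omega> \<in> graph_ends V E. end_lives_in \<omega> C}"
      | y z t where "p = Pt (edge_point y z t)"
          "y \<in> C" "z \<in> S" "(y, z) \<in> E" "0 < t" "t < 1" "t < \<delta>"
      unfolding end_nbhd_def by blast
    then show "p \<in> end_nbhd V E T D \<epsilon>"
    proof cases
      case 1
      with cc show ?thesis unfolding end_nbhd_def by blast
    next
      case 2
      with ee show ?thesis unfolding end_nbhd_def by blast
    next
      case 3
      with pp show ?thesis by simp
    qed
  qed
qed

lemma freudenthal_open_Int:
  assumes "simple_graph V E" "freudenthal_open V E U" "freudenthal_open V E W"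
  shows "freudenthal_open V E (U \<inter> W)"
  unfolding freudenthal_open_def
proof (intro conjI allI impI ballI)
  show "U \<inter> W \<subseteq> freudenthal_points V E"
    using assms by (auto simp: freudenthal_open_def)
next
  fix e assume "e \<in> E"
  moreover obtain u v where "e = (u, v)" by (cases e)
  ultimately have "openin (top_of_set {0..1}) {t \<in> {0..1::real}. Pt (edge_point u v t) \<in> U}"
    "openin (top_of_set {0..1}) {t \<in> {0..1::real}. Pt (edge_point u v t) \<in> W}"
    using assms(2,3) unfolding freudenthal_open_def by blast+
  then have "openin (top_of_set {0..1}) ({t \<in> {0..1::real}. Pt (edge_point u v t) \<in> U}
      \<inter> {t \<in> {0..1}. Pt (edge_point u v t) \<in> W})"
    by (rule openin_Int)
  moreover have "{t \<in> {0..1::real}. Pt (edge_point u v t) \<in> U}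
      \<inter> {t \<in> {0..1}. Pt (edge_point u v t) \<in> W} = {t \<in> {0..1}. Pt (edge_point u v t) \<in> U \<inter> W}"
    by auto
  ultimately show "case e of (u, v) \<Rightarrow>
      openin (top_of_set {0..1}) {t \<in> {0..1}. Pt (edge_point u v t) \<in> U \<inter> W}"
    using \<open>e = (u, v)\<close> by simp
next
  fix \<omega> assume \<omega>: "End \<omega> \<in> U \<inter> W"
  have sym: "sym E" using assms by (simp add: simple_graph_def)
  have wend: "\<omega> \<in> graph_ends V E"
    using \<omega> assms(2) by (auto simp: freudenthal_open_def freudenthal_points_def)
  obtain S1 C1 \<epsilon>1 where 1: "finite S1" "S1 \<subseteq> V" "C1 \<in> components_minus V E S1"
    "end_lives_in \<omega> C1" "\<epsilon>1 > 0" "end_nbhd V E S1 C1 \<epsilon>1 \<subseteq> U"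
    using \<omega> assms(2) unfolding freudenthal_open_def by blast
  obtain S2 C2 \<epsilon>2 where 2: "finite S2" "S2 \<subseteq> V" "C2 \<in> components_minus V E S2"
    "end_lives_in \<omega> C2" "\<epsilon>2 > 0" "end_nbhd V E S2 C2 \<epsilon>2 \<subseteq> W"
    using \<omega> assms(3) unfolding freudenthal_open_def by blast
  obtain C where C: "C \<in> components_minus V E (S1 \<union> S2)" "end_lives_in \<omega> C"
    using ex1_end_component[OF sym wend, of "S1 \<union> S2"] 1 2 by auto
  obtain \<rho> where "\<rho> \<in> \<omega>"
    using wend equiv_ray_equiv[OF sym, of V] in_quotient_imp_non_empty
    unfolding graph_ends_def by blast
  then obtain x1 x2 where x: "x1 \<in> C" "x1 \<in> C1" "x2 \<in> C" "x2 \<in> C2"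
    using tails_meet C(2) 1(4) 2(4) unfolding end_lives_in_def by meson
  have "end_nbhd V E (S1 \<union> S2) C (min \<epsilon>1 \<epsilon>2) \<subseteq> end_nbhd V E S1 C1 \<epsilon>1"
    using end_nbhd_mono[OF assms(1) C(1) 1(3)] x 1 2 by auto
  moreover have "end_nbhd V E (S1 \<union> S2) C (min \<epsilon>1 \<epsilon>2) \<subseteq> end_nbhd V E S2 C2 \<epsilon>2"
    using end_nbhd_mono[OF assms(1) C(1) 2(3)] x 1 2 by auto
  ultimately show "\<exists>S C \<epsilon>. finite S \<and> S \<subseteq> V \<and> C \<in> components_minus V E S \<and>
      end_lives_in \<omega> C \<and> \<epsilon> > 0 \<and> end_nbhd V E S C \<epsilon> \<subseteq> U \<inter> W"
    using 1 2 C
    by (intro exI[of _ "S1 \<union> S2"] exI[of _ C] exI[of _ "min \<epsilon>1 \<epsilon>2"]) auto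
qed

lemma freudenthal_open_Union:
  assumes "\<And>U. U \<in> \<U> \<Longrightarrow> freudenthal_open V E U"
  shows "freudenthal_open V E (\<Union>\<U>)"
  unfolding freudenthal_open_def
proof (intro conjI allI impI ballI)
  show "\<Union>\<U> \<subseteq> freudenthal_points V E"
    using assms unfolding freudenthal_open_def by (intro Union_least) blast
next
  fix e assume "e \<in> E"
  obtain u v where e: "e = (u, v)" by (cases e)
  have "openin (top_of_set {0..1}) (\<Union>U\<in>\<U>. {t \<in> {0..1::real}. Pt (edge_point u v t) \<in> U})"
    using assms \<open>e \<in> E\<close> e unfolding freudenthal_open_def by (intro openin_Union) blast
  moreover have "(\<Union>U\<in>\<U>. {t \<in> {0..1::real}. Pt (edge_point u v t) \<in> U})
      = {t \<in> {0..1}. Pt (edge_point u v t) \<in> \<Union>\<U>}" by auto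
  ultimately show "case e of (u, v) \<Rightarrow>
      openin (top_of_set {0..1}) {t \<in> {0..1}. Pt (edge_point u v t) \<in> \<Union>\<U>}"
    using e by simp
next
  fix \<omega> assume "End \<omega> \<in> \<Union>\<U>"
  then obtain U where U: "U \<in> \<U>" "End \<omega> \<in> U" by blast
  then have "\<exists>S C \<epsilon>. finite S \<and> S \<subseteq> V \<and> C \<in> components_minus V E S \<and>
      end_lives_in \<omega> C \<and> \<epsilon> > 0 \<and> end_nbhd V E S C \<epsilon> \<subseteq> U"
    using assms[OF U(1)] unfolding freudenthal_open_def by blast
  with U(1) show "\<exists>S C \<epsilon>. finite S \<and> S \<subseteq> V \<and> C \<in> components_minus V E S \<and>
      end_lives_in \<omega> C \<and> \<epsilon> > 0 \<and> end_nbhd V E S C \<epsilon> \<subseteq> \<Union>\<U>"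
    by (meson Union_upper order_trans)
qed

lemma openin_freudenthal:
  assumes "simple_graph V E"
  shows "openin (freudenthal V E) U \<longleftrightarrow> freudenthal_open V E U"
proof -
  have "istopology (freudenthal_open V E)"
    unfolding istopology_def
    using freudenthal_open_Int[OF assms] freudenthal_open_Union by blast
  then show ?thesis by (simp add: freudenthal_def)
qed

lemma topspace_freudenthal:
  assumes "simple_graph V E"
  shows "topspace (freudenthal V E) = freudenthal_points V E"
proof -
  have V: "E \<subseteq> V \<times> V" and sym: "sym E" using assms by (auto simp: simple_graph_def)
  have inV: "C \<subseteq> V" if "C \<in> components_minus V E S" for C S
    using component_subset[OF that] by blast
  have nb: "end_nbhd V E S C 1 \<subseteq> freudenthal_points V E" if "C \<in> components_minus V E S" for C S
  proof -
    have "one_complex C (induced_edges E C) \<subseteq> one_complex V E"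
      using inV[OF that] unfolding one_complex_def induced_edges_def by blast
    moreover have "edge_point y x t \<in> one_complex V E" if "(y, x) \<in> E" "0 < t" "t < 1" for y x t
    proof -
      have "0 \<le> t \<and> t \<le> 1" using that by simp
      with that show ?thesis unfolding one_complex_def by blast
    qed
    ultimately show ?thesis
      unfolding end_nbhd_def freudenthal_points_def by blast
  qed
  have "freudenthal_open V E (freudenthal_points V E)"
    unfolding freudenthal_open_def
  proof (intro conjI allI impI ballI)
    fix e assume "e \<in> E"
    obtain u v where e: "e = (u, v)" by (cases e)
    have "Pt (edge_point u v t) \<in> freudenthal_points V E" if "t \<in> {0..1}" for t
    proof -
      have "edge_point u v t \<in> one_complex V E"
        using that \<open>e \<in> E\<close> e unfolding one_complex_def by fastforce
      then show ?thesis by (simp add: freudenthal_points_def)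
    qed
    then have "{t \<in> {0..1::real}. Pt (edge_point u v t) \<in> freudenthal_points V E} = {0..1}"
      by blast
    then show "case e of (u, v) \<Rightarrow> openin (top_of_set {0..1})
        {t \<in> {0..1}. Pt (edge_point u v t) \<in> freudenthal_points V E}"
      using e by simp
  next
    fix \<omega> assume "End \<omega> \<in> freudenthal_points V E"
    then have "\<omega> \<in> graph_ends V E" by (auto simp: freudenthal_points_def)
    then obtain C where "C \<in> components_minus V E {}" "end_lives_in \<omega> C"
      using ex1_end_component[OF sym, of \<omega> V "{}"] by auto
    then show "\<exists>S C \<epsilon>. finite S \<and> S \<subseteq> V \<and> C \<in> components_minus V E S \<and>
        end_lives_in \<omega> C \<and> \<epsilon> > 0 \<and> end_nbhd V E S C \<epsilon> \<subseteq> freudenthal_points V E"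
      using nb[of C "{}"] by (intro exI[of _ "{}"] exI[of _ C] exI[of _ 1]) auto
  qed simp
  then show ?thesis
    unfolding topspace_def openin_freudenthal[OF assms]
    by (auto simp: freudenthal_open_def)
qed

end

theory Submission
  imports Defs
begin

text \<open>
  The witness is a two-way infinite cable. Its columns are indexed by the integers and consist of
  four vertices each, the rows \<open>0\<close> to \<open>3\<close>; two vertices in equal or consecutive columns are always
  adjacent. Moreover each of the row edges, which join \<open>strand i j\<close> to \<open>strand (i + 1) j\<close>, carries
  an ear: a vertex \<open>ear i j\<close> adjacent to exactly these two.
  
  A ball of radius \<open>r \<ge> 1\<close> is a triangle or consists of several consecutive full columns together
  with some of the ears between them. In the second case a Hamilton cycle runs along the four rows,
  alternately to the right and to the left, passes through every ear it meets that lies in the ball,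
  and changes rows within the last and the first column (\<open>hamiltonian_cable_segment\<close>).
  
  Globally no such turning back is possible. A circle through all vertices contains both edges at
  every vertex of degree two (\<open>circle_contains_edges_at_degree_two\<close>), so it contains all four rows in
  the form of double rays through the ears. At either side of the cable the four rows run into one
  and the same end (\<open>rows_meet_at_an_end\<close>), and the circle would have to pass through that end more
  than once. To get a contradiction without discussing how a circle passes through an end, remove
  from the circle the two points \<open>ear 0 0\<close> and \<open>ear 0 1\<close>. This should disconnect it. But all rows
  still hang together at the right end and at the left end, and row \<open>2\<close> joins the two sides.
  
  The last argument is carried out on vertices alone: a separation of the circle without two of its
  vertices induces a colouring of the other vertices that is constant along edges of the circle and
  along rays converging to a common end (\<open>hamilton_circle_minus_two_vertices_colouring\<close>). On the
  cable such a colouring is constant, which is absurd.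
\<close>
section \<open>Points of the circle are not cut points, pairs of points are\<close>

lemma connected_punctured_circle: "connected (sphere (0::complex) 1 - {b})"
proof (cases "b \<in> sphere 0 1")
  case True
  then have "(sphere 0 1 - {b}) homeomorphic (UNIV :: real set)"
    by (intro homeomorphic_punctured_sphere_affine) auto
  then show ?thesis by (simp add: homeomorphic_connectedness)
next
  case False
  then have "sphere 0 1 - {b} = sphere 0 1" by simp
  then show ?thesis by (metis DIM_complex connected_sphere order_refl)
qed

lemma disconnected_doubly_punctured_circle:
  assumes "b \<in> sphere (0::complex) 1" "c \<in> sphere 0 1" "b \<noteq> c"
  shows "\<not> connected (sphere (0::complex) 1 - {b, c})"
proof
  assume con: "connected (sphere (0::complex) 1 - {b, c})"
  have "(sphere 0 1 - {b}) homeomorphic (UNIV :: real set)"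
    using assms(1) by (intro homeomorphic_punctured_sphere_affine) auto
  then obtain f g where fg: "homeomorphism (sphere 0 1 - {b}) (UNIV :: real set) f g"
    unfolding homeomorphic_def by blast
  have img: "f ` (sphere 0 1 - {b, c}) = UNIV - {f c}"
  proof -
    have "inj_on f (sphere 0 1 - {b})" "f ` (sphere 0 1 - {b}) = UNIV"
      using fg by (auto simp: homeomorphism_def intro: inj_on_inverseI[where g = g])
    moreover have "sphere 0 1 - {b, c} = (sphere 0 1 - {b}) - {c}" by auto
    ultimately show ?thesis using assms by (simp add: inj_on_image_set_diff[of f "sphere 0 1 - {b}"])
  qed
  \<comment> \<open>The circle without \<open>b\<close> is a real line, and a line without a point is not an interval.\<close>
  have "connected (f ` (sphere 0 1 - {b, c}))"
    using con fg by (intro connected_continuous_image)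
      (auto simp: homeomorphism_def intro: continuous_on_subset)
  then have "connected (UNIV - {f c})" by (simp add: img)
  then have "f c \<in> UNIV - {f c}"
    by (rule connectedD_interval[of _ "f c - 1" "f c + 1"]) auto
  then show False by simp
qed

text \<open>
  Transports questions about removing points from an abstract circle to the unit circle. The
  removed set is arbitrary so that the cases of one and of two points, and of points outside the
  circle, are covered at once.
\<close>
lemma circle_in_Diff:
  assumes "circle_in X K"
  shows "\<exists>f. bij_betw f K (sphere (0::complex) 1) \<and>
    (\<forall>Y. connectedin X (K - Y) \<longleftrightarrow> connected (sphere (0::complex) 1 - f ` (Y \<inter> K)))"
proof -
  have KX: "K \<subseteq> topspace X" using assms by (simp add: circle_in_def)
  obtain f where f: "homeomorphic_map (subtopology X K) (top_of_set (sphere (0::complex) 1)) f"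
    using assms unfolding circle_in_def homeomorphic_space by blast
  have top: "topspace (subtopology X K) = K" using KX by auto
  have inj: "inj_on f K" and im: "f ` K = sphere 0 1"
    using f top by (metis homeomorphic_imp_injective_map,
        metis homeomorphic_imp_surjective_map topspace_euclidean_subtopology)
  have "connectedin X (K - Y) \<longleftrightarrow> connected (sphere (0::complex) 1 - f ` (Y \<inter> K))" for Y
  proof -
    have "K - Y = K - (Y \<inter> K)" by blast
    then have e: "f ` (K - Y) = sphere 0 1 - f ` (Y \<inter> K)"
      using im inj_on_image_set_diff[OF inj, of K "Y \<inter> K"] by simp
    have "connectedin X (K - Y) \<longleftrightarrow> connectedin (subtopology X K) (K - Y)"
      by (simp add: connectedin_subtopology)
    also have "\<dots> \<longleftrightarrow> connectedin (top_of_set (sphere (0::complex) 1)) (f ` (K - Y))"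
      using homeomorphic_map_connectedness[OF f, of "K - Y"] top by auto
    also have "\<dots> \<longleftrightarrow> connected (f ` (K - Y))"
      using im by (auto simp: connectedin_subtopology)
    finally show ?thesis by (simp only: e)
  qed
  with inj im show ?thesis by (auto simp: bij_betw_def)
qed

lemma circle_in_minus_point_connected:
  assumes "circle_in X K"
  shows "connectedin X (K - {y})"
proof -
  obtain f where f: "bij_betw f K (sphere (0::complex) 1)"
    "\<And>Y. connectedin X (K - Y) \<longleftrightarrow> connected (sphere (0::complex) 1 - f ` (Y \<inter> K))"
    using circle_in_Diff[OF assms] by blast
  show ?thesis
  proof (cases "y \<in> K")
    case True
    then show ?thesis by (simp add: f(2) connected_punctured_circle)
  next
    case False
    then have "{y} \<inter> K = {}" by simp
    moreover have "connected (sphere (0::complex) 1)"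
      using connected_punctured_circle[of 0] by simp
    ultimately show ?thesis by (simp only: f(2) image_empty Diff_empty)
  qed
qed

lemma circle_in_minus_two_points_disconnected:
  assumes "circle_in X K" "p \<in> K" "q \<in> K" "p \<noteq> q"
  shows "\<not> connectedin X (K - {p, q})"
proof -
  obtain f where f: "bij_betw f K (sphere (0::complex) 1)"
    "\<And>Y. connectedin X (K - Y) \<longleftrightarrow> connected (sphere (0::complex) 1 - f ` (Y \<inter> K))"
    using circle_in_Diff[OF assms(1)] by blast
  have "f p \<in> sphere 0 1" "f q \<in> sphere 0 1" "f p \<noteq> f q"
    using f(1) assms by (auto simp: bij_betw_def inj_on_def)
  with assms show ?thesis
    by (simp add: f(2) disconnected_doubly_punctured_circle del: mem_sphere)
qed

section \<open>Barycentric coordinates on the compactification\<close>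

text \<open>
  The set of points of an edge near one of its endpoints is awkward to recognise as open from the
  definition of the topology. With the barycentric coordinate of a vertex, extended by \<open>0\<close> to the
  ends, such sets are given by strict inequalities between continuous functions.
\<close>
fun coord :: "'a \<Rightarrow> 'a fpoint \<Rightarrow> real" where
  "coord w (Pt f) = f w"
| "coord w (End \<omega>) = 0"

lemma vertex_point_apply: "vertex_point u w = (if w = u then 1 else 0)"
  by (simp add: vertex_point_def)

lemma vertex_point_inject [simp]: "vertex_point u = vertex_point w \<longleftrightarrow> u = w"
proof
  assume "vertex_point u = vertex_point w"
  then have "vertex_point u u = vertex_point w u" by simp
  then show "u = w" by (simp add: vertex_point_apply split: if_splits)
qed simp

lemma edge_point_0: "edge_point u v 0 = vertex_point u"
  and edge_point_1: "edge_point u v 1 = vertex_point v"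
  by (simp_all add: edge_point_def)

lemma edge_point_commute: "edge_point v u t = edge_point u v (1 - t)"
  by (auto simp: edge_point_def)

lemma edge_point_in_complex:
  assumes "(u, v) \<in> E" "0 \<le> t" "t \<le> 1"
  shows "edge_point u v t \<in> one_complex V E"
  using assms unfolding one_complex_def by blast

lemma freudenthal_pointsE:
  assumes "simple_graph V E" "x \<in> freudenthal_points V E"
  obtains (vertex) u where "u \<in> V" "x = Pt (vertex_point u)"
    | (edge) u v t where "(u, v) \<in> E" "0 < t" "t < 1" "x = Pt (edge_point u v t)"
    | (ending) \<omega> where "\<omega> \<in> graph_ends V E" "x = End \<omega>"
proof -
  consider (v) u where "u \<in> V" "x = Pt (vertex_point u)"
    | (e) u v t where "(u, v) \<in> E" "0 \<le> t" "t \<le> 1" "x = Pt (edge_point u v t)"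
    | (n) \<omega> where "\<omega> \<in> graph_ends V E" "x = End \<omega>"
    using assms(2) unfolding freudenthal_points_def one_complex_def by blast
  then show thesis
  proof cases
    case e
    have "u \<in> V" "v \<in> V" using e(1) assms(1) by (auto simp: simple_graph_def)
    with e show thesis
      using vertex[of u] vertex[of v] edge[of u v t]
      by (cases "t = 0"; cases "t = 1") (auto simp: edge_point_0 edge_point_1)
  qed (use vertex ending in blast)+
qed

lemma end_nbhd_subset:
  assumes "simple_graph V E" "C \<in> components_minus V E S"
  shows "end_nbhd V E S C \<epsilon> \<subseteq> freudenthal_points V E"
proof -
  have "C \<subseteq> V" using component_subset[OF assms(2)] by blast
  then have "one_complex C (induced_edges E C) \<subseteq> one_complex V E"
    unfolding one_complex_def induced_edges_def by blast
  then show ?thesis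
    unfolding end_nbhd_def freudenthal_points_def
    by (auto intro!: imageI edge_point_in_complex)
qed

text \<open>
  At an end \<open>\<omega>\<close> continuity holds because the neighbourhood of \<open>\<omega>\<close> given by \<open>S = {w}\<close> and \<open>\<epsilon>\<close>
  meets the open star of \<open>w\<close> only in points whose distance from the other endpoint is less than
  \<open>\<epsilon>\<close>, that is, whose \<open>w\<close>-coordinate is less than \<open>\<epsilon>\<close>.
\<close>
lemma continuous_coord:
  assumes G: "simple_graph V E" and "w \<in> V"
  shows "continuous_map (freudenthal V E) euclideanreal (coord w)"
  unfolding continuous_map_def
proof (intro conjI allI impI)
  fix U :: "real set" assume "openin euclideanreal U"
  then have U: "open U" by simp
  let ?P = "{x \<in> topspace (freudenthal V E). coord w x \<in> U}"
  have sym: "sym E" using G by (simp add: simple_graph_def)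
  have "freudenthal_open V E ?P"
    unfolding freudenthal_open_def
  proof (intro conjI allI impI ballI)
    fix e assume "e \<in> E"
    obtain u v where e: "e = (u, v)" by (cases e)
    have "{t \<in> {0..1}. Pt (edge_point u v t) \<in> ?P} = {t \<in> {0..1}. edge_point u v t w \<in> U}"
      using \<open>e \<in> E\<close> e edge_point_in_complex[of u v E _ V]
      by (auto simp: topspace_freudenthal[OF G] freudenthal_points_def)
    also have "\<dots> = {0..1} \<inter> (\<lambda>t. edge_point u v t w) -` U" by auto
    also have "openin (top_of_set {0..1}) \<dots>"
      using U by (intro continuous_openin_preimage_gen)
        (auto simp: edge_point_def intro!: continuous_intros)
    finally show "case e of (u, v) \<Rightarrow> openin (top_of_set {0..1}) {t \<in> {0..1}. Pt (edge_point u v t) \<in> ?P}"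
      using e by simp
  next
    fix \<omega> assume \<omega>: "End \<omega> \<in> ?P"
    then have "0 \<in> U" "\<omega> \<in> graph_ends V E"
      by (auto simp: topspace_freudenthal[OF G] freudenthal_points_def)
    then obtain \<epsilon> where \<epsilon>: "\<epsilon> > 0" "ball 0 \<epsilon> \<subseteq> U" using U open_contains_ball by blast
    obtain C where C: "C \<in> components_minus V E {w}" "end_lives_in \<omega> C"
      using ex1_end_component[OF sym \<open>\<omega> \<in> graph_ends V E\<close>, of "{w}"] \<open>w \<in> V\<close> by auto
    have wC: "w \<notin> C" using component_subset[OF C(1)] by blast
    have "coord w x \<in> U" if x: "x \<in> end_nbhd V E {w} C \<epsilon>" for x
    proof -
      have "\<bar>coord w x\<bar> < \<epsilon>"
        using x wC \<epsilon>(1) unfolding end_nbhd_def one_complex_def induced_edges_def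
        by (auto simp: vertex_point_apply edge_point_def)
      then show ?thesis using \<epsilon>(2) by (auto simp: dist_real_def)
    qed
    then have "end_nbhd V E {w} C \<epsilon> \<subseteq> ?P"
      using end_nbhd_subset[OF G C(1)] by (auto simp: topspace_freudenthal[OF G])
    with C \<epsilon> \<open>w \<in> V\<close> show "\<exists>S C \<epsilon>. finite S \<and> S \<subseteq> V \<and> C \<in> components_minus V E S \<and>
        end_lives_in \<omega> C \<and> \<epsilon> > 0 \<and> end_nbhd V E S C \<epsilon> \<subseteq> ?P"
      by (intro exI[of _ "{w}"] exI[of _ C] exI[of _ \<epsilon>]) auto
  qed (auto simp: topspace_freudenthal[OF G])
  then show "openin (freudenthal V E) ?P" by (simp add: openin_freudenthal[OF G])
qed auto

lemma continuous_edge_point: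
  assumes G: "simple_graph V E" and "(u, v) \<in> E"
  shows "continuous_map (top_of_set {0..1}) (freudenthal V E) (\<lambda>t. Pt (edge_point u v t))"
  unfolding continuous_map_def
proof (intro conjI allI impI)
  show "(\<lambda>t. Pt (edge_point u v t)) \<in> topspace (top_of_set {0..1}) \<rightarrow> topspace (freudenthal V E)"
    using edge_point_in_complex[OF assms(2)]
    by (auto simp: topspace_freudenthal[OF G] freudenthal_points_def)
next
  fix U assume "openin (freudenthal V E) U"
  then show "openin (top_of_set {0..1}) {t \<in> topspace (top_of_set {0..1}). Pt (edge_point u v t) \<in> U}"
    using assms(2) by (auto simp: openin_freudenthal[OF G] freudenthal_open_def)
qed

lemma connectedin_edge_segment:
  assumes "simple_graph V E" "(u, v) \<in> E" "0 \<le> s" "s \<le> 1"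
  shows "connectedin (freudenthal V E) ((\<lambda>t. Pt (edge_point u v t)) ` {0..s})"
  using assms by (intro connectedin_continuous_map_image[OF continuous_edge_point])
    (auto simp: connectedin_subtopology)

section \<open>Edges in a circle through all vertices\<close>

lemma coord_ge_0:
  assumes "simple_graph V E" "x \<in> freudenthal_points V E"
  shows "coord w x \<ge> 0"
  using assms by (cases rule: freudenthal_pointsE) (auto simp: vertex_point_apply edge_point_def)

lemma coord_sum_le_1:
  assumes "simple_graph V E" "x \<in> freudenthal_points V E" "u \<noteq> v"
  shows "coord u x + coord v x \<le> 1"
  using assms(1,2,3)
  by (cases rule: freudenthal_pointsE) (auto simp: vertex_point_apply edge_point_def)

lemma point_on_edge:
  assumes "simple_graph V E" "x \<in> freudenthal_points V E" "u \<noteq> v"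
    and "coord u x > 0" "coord v x > 0"
  shows "Pt (edge_point u v (coord v x)) = x" and "coord u x + coord v x = 1"
proof -
  have "Pt (edge_point u v (coord v x)) = x \<and> coord u x + coord v x = 1"
    using assms(1,2)
  proof (cases rule: freudenthal_pointsE)
    case (edge a b t)
    have "a \<noteq> b" using assms(1) edge(1) by (auto simp: simple_graph_def irrefl_def)
    have "(u = a \<and> v = b) \<or> (u = b \<and> v = a)"
      using assms(3-5) edge by (auto simp: edge_point_def vertex_point_apply split: if_splits)
    then show ?thesis
    proof
      assume "u = a \<and> v = b"
      with edge \<open>a \<noteq> b\<close> show ?thesis by (auto simp: edge_point_def vertex_point_apply)
    next
      assume "u = b \<and> v = a"
      with edge \<open>a \<noteq> b\<close> show ?thesis
        by (auto simp: edge_point_def vertex_point_apply)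
    qed
  qed (use assms in \<open>auto simp: vertex_point_apply split: if_splits\<close>)
  then show "Pt (edge_point u v (coord v x)) = x" and "coord u x + coord v x = 1" by auto
qed

lemma coord_eq_1:
  assumes "simple_graph V E" "x \<in> freudenthal_points V E" "coord v x = 1"
  shows "x = Pt (vertex_point v)"
  using assms(1,2)
proof (cases rule: freudenthal_pointsE)
  case (edge a b t)
  have "a \<noteq> b" using assms(1) edge(1) by (auto simp: simple_graph_def irrefl_def)
  with edge assms(3) show ?thesis
    by (auto simp: edge_point_def vertex_point_apply split: if_splits)
qed (use assms in \<open>auto simp: vertex_point_apply split: if_splits\<close>)

lemma openin_coord_less:
  assumes "simple_graph V E" "w \<in> V"
  shows "openin (freudenthal V E) {x \<in> freudenthal_points V E. coord w x < c}"
    and "openin (freudenthal V E) {x \<in> freudenthal_points V E. c < coord w x}"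
proof -
  have *: "openin (freudenthal V E) {x \<in> freudenthal_points V E. coord w x \<in> U}" if "open U" for U
    using openin_continuous_map_preimage[OF continuous_coord[OF assms], of U] that
    by (simp add: topspace_freudenthal[OF assms(1)])
  show "openin (freudenthal V E) {x \<in> freudenthal_points V E. coord w x < c}"
    using *[of "{..<c}"] by simp
  show "openin (freudenthal V E) {x \<in> freudenthal_points V E. c < coord w x}"
    using *[of "{c<..}"] by simp
qed

lemma openin_coord_sum_less:
  assumes "simple_graph V E" "u \<in> V" "v \<in> V"
  shows "openin (freudenthal V E) {x \<in> freudenthal_points V E. coord u x + coord v x < c}"
proof -
  have "continuous_map (freudenthal V E) euclideanreal (\<lambda>x. coord u x + coord v x)"
    using assms by (intro continuous_map_add continuous_coord)
  from openin_continuous_map_preimage[OF this, of "{..<c}"] show ?thesis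
    by (simp add: topspace_freudenthal[OF assms(1)])
qed

lemma connectedin_not_separated:
  assumes "connectedin X T" "openin X A" "openin X B" "T \<subseteq> A \<union> B" "A \<inter> B = {}"
    and "x \<in> T" "x \<in> A" "y \<in> T" "y \<in> B"
  shows False
  using assms unfolding connectedin by blast

text \<open>
  If a point \<open>m\<close> between \<open>u\<close> and the given point of the edge were missing from the circle, then
  removing \<open>v\<close> would cut off the part of the edge between \<open>m\<close> and \<open>v\<close> from \<open>u\<close>, although a circle
  minus one point is connected. The sets \<open>A\<close> and \<open>B\<close> of the proof are the open segment from \<open>m\<close>
  to \<open>v\<close> and the complement of the closed one, in terms of coordinates.
\<close>
lemma circle_contains_initial_segment:
  assumes G: "simple_graph V E" and circ: "circle_in (freudenthal V E) K"
    and verts: "\<And>v. v \<in> V \<Longrightarrow> Pt (vertex_point v) \<in> K"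
    and uv: "(u, v) \<in> E" and s: "0 < s" "s < 1" "Pt (edge_point u v s) \<in> K"
    and t: "0 \<le> t" "t \<le> s"
  shows "Pt (edge_point u v t) \<in> K"
proof (rule ccontr)
  assume miss: "Pt (edge_point u v t) \<notin> K"
  have K: "K \<subseteq> freudenthal_points V E"
    using circ by (auto simp: circle_in_def topspace_freudenthal[OF G])
  have V: "u \<in> V" "v \<in> V" "u \<noteq> v"
    using G uv by (auto simp: simple_graph_def irrefl_def)
  have "t \<noteq> 0" using miss verts V by (auto simp: edge_point_0)
  moreover have "t \<noteq> s" using miss s by auto
  ultimately have t': "0 < t" "t < s" using t by auto
  let ?P = "freudenthal_points V E"
  define A where "A = {x \<in> ?P. 0 < coord u x} \<inter> {x \<in> ?P. t < coord v x}"
  define B where "B = {x \<in> ?P. coord v x < t} \<union> {x \<in> ?P. coord u x + coord v x < 1}"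
  show False
  proof (rule connectedin_not_separated[OF circle_in_minus_point_connected[OF circ]])
    show "openin (freudenthal V E) A" "openin (freudenthal V E) B"
      unfolding A_def B_def
      by (intro openin_Un openin_Int openin_coord_less[OF G] openin_coord_sum_less[OF G] V)+
    show "A \<inter> B = {}"
    proof -
      have False if "x \<in> A" "x \<in> B" for x
        using that point_on_edge(2)[OF G, of x u v] V t' unfolding A_def B_def by auto
      then show ?thesis by blast
    qed
    show "K - {Pt (vertex_point v)} \<subseteq> A \<union> B"
    proof
      fix x assume x: "x \<in> K - {Pt (vertex_point v)}"
      then have xP: "x \<in> ?P" using K by auto
      have "coord u x \<ge> 0" "coord u x + coord v x \<le> 1"
        using coord_ge_0[OF G xP] coord_sum_le_1[OF G xP] V by auto
      moreover have "coord v x \<noteq> 1" using coord_eq_1[OF G xP] x by auto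
      \<comment> \<open>On the edge, \<open>coord v x = t\<close> describes just the missing point.\<close>
      moreover have "coord v x \<noteq> t" if "0 < coord u x"
        using point_on_edge(1)[OF G xP V(3) that] t' miss x by auto
      ultimately consider "0 < coord u x" "t < coord v x" | "coord v x < t"
        | "coord u x + coord v x < 1" by linarith
      then show "x \<in> A \<union> B" using xP by cases (simp_all add: A_def B_def)
    qed
    have cs: "coord u (Pt (edge_point u v s)) = 1 - s" "coord v (Pt (edge_point u v s)) = s"
      using V(3) by (auto simp: edge_point_def vertex_point_apply)
    have "Pt (edge_point u v s) \<noteq> Pt (vertex_point v)"
      using cs(2) s by (metis coord.simps(1) less_irrefl vertex_point_apply)
    then show "Pt (edge_point u v s) \<in> K - {Pt (vertex_point v)}" using s by simp
    show "Pt (edge_point u v s) \<in> A"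
      using subsetD[OF K s(3)] s t' cs by (simp add: A_def)
    have "Pt (vertex_point u) \<noteq> Pt (vertex_point v)"
      using V(3) by (metis fpoint.inject(1) vertex_point_apply zero_neq_one)
    then show "Pt (vertex_point u) \<in> K - {Pt (vertex_point v)}" using verts V by simp
    show "Pt (vertex_point u) \<in> B"
      using subsetD[OF K verts[of u]] V t' by (simp add: B_def vertex_point_apply)
  qed
qed

lemma circle_contains_edge:
  assumes G: "simple_graph V E" and circ: "circle_in (freudenthal V E) K"
    and verts: "\<And>v. v \<in> V \<Longrightarrow> Pt (vertex_point v) \<in> K"
    and uv: "(u, v) \<in> E" and s: "0 < s" "s < 1" "Pt (edge_point u v s) \<in> K"
    and t: "0 \<le> t" "t \<le> 1"
  shows "Pt (edge_point u v t) \<in> K"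
proof (cases "t \<le> s")
  case True
  then show ?thesis using circle_contains_initial_segment[OF G circ verts uv s] t by simp
next
  case False
  have "(v, u) \<in> E" using uv G by (auto simp: simple_graph_def sym_def)
  then have "Pt (edge_point v u (1 - t)) \<in> K"
    using circle_contains_initial_segment[OF G circ verts \<open>(v, u) \<in> E\<close>, of "1 - s" "1 - t"] s t False
    by (simp add: edge_point_commute[of v u])
  then show ?thesis by (simp add: edge_point_commute[of v u])
qed

text \<open>
  If a point \<open>m\<close> of the edge \<open>ea\<close> were missing from the circle, then removing \<open>b\<close> would cut off
  \<open>e\<close> from \<open>a\<close>: the path from \<open>m\<close> through \<open>e\<close> to \<open>b\<close> can be left only at its two ends. Here \<open>A\<close>
  is that path without its ends, and \<open>B\<close> is the complement of the closed path.
\<close>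
lemma circle_contains_edges_at_degree_two:
  assumes G: "simple_graph V E" and circ: "circle_in (freudenthal V E) K"
    and verts: "\<And>v. v \<in> V \<Longrightarrow> Pt (vertex_point v) \<in> K"
    and deg: "E `` {e} = {a, b}" "a \<noteq> b"
    and t: "0 \<le> t" "t \<le> 1"
  shows "Pt (edge_point e a t) \<in> K"
proof (rule ccontr)
  assume miss: "Pt (edge_point e a t) \<notin> K"
  have K: "K \<subseteq> freudenthal_points V E"
    using circ by (auto simp: circle_in_def topspace_freudenthal[OF G])
  have E: "(e, a) \<in> E" "(e, b) \<in> E" using deg by auto
  then have V: "e \<in> V" "a \<in> V" "b \<in> V" "e \<noteq> a" "e \<noteq> b"
    using G by (auto simp: simple_graph_def irrefl_def)
  have "t \<noteq> 0" "t \<noteq> 1" using miss verts V by (auto simp: edge_point_0 edge_point_1)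
  then have t': "0 < t" "t < 1" using t by auto
  let ?P = "freudenthal_points V E"
  define A where "A = {x \<in> ?P. 1 - t < coord e x} \<union>
    ({x \<in> ?P. 0 < coord e x} \<inter> {x \<in> ?P. 0 < coord b x})"
  define B where "B = {x \<in> ?P. coord e x < 1 - t} \<inter> {x \<in> ?P. coord e x + coord b x < 1}"
  show False
  proof (rule connectedin_not_separated[OF circle_in_minus_point_connected[OF circ]])
    show "openin (freudenthal V E) A" "openin (freudenthal V E) B"
      unfolding A_def B_def
      by (intro openin_Un openin_Int openin_coord_less[OF G] openin_coord_sum_less[OF G] V)+
    show "A \<inter> B = {}"
    proof -
      have False if "x \<in> A" "x \<in> B" for x
        using that point_on_edge(2)[OF G, of x e b] V t' unfolding A_def B_def by auto
      then show ?thesis by blast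
    qed
    show "K - {Pt (vertex_point b)} \<subseteq> A \<union> B"
    proof
      fix x assume x: "x \<in> K - {Pt (vertex_point b)}"
      then have xP: "x \<in> ?P" using K by auto
      have bnd: "coord e x \<ge> 0" "coord b x \<ge> 0" "coord e x + coord b x \<le> 1"
        using coord_ge_0[OF G xP] coord_sum_le_1[OF G xP] V by auto
      have b1: "coord b x \<noteq> 1" using coord_eq_1[OF G xP] x by auto
      \<comment> \<open>Where the \<open>b\<close>-coordinate vanishes, this coordinate singles out the missing point, as \<open>e\<close> has no third edge.\<close>
      have "coord e x \<noteq> 1 - t" if "coord b x = 0"
      proof
        assume et: "coord e x = 1 - t"
        show False using G xP
        proof (cases rule: freudenthal_pointsE)
          case (edge u w r)
          have uw: "u \<noteq> w" "(w, u) \<in> E"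
            using edge G by (auto simp: simple_graph_def irrefl_def sym_def)
          have "(u = e \<and> w = a \<and> r = t) \<or> (w = e \<and> u = a \<and> r = 1 - t)"
            using edge uw deg that et t'
            by (auto simp: edge_point_def vertex_point_apply split: if_splits)
          then show False using edge miss x by (auto simp: edge_point_commute[of a e])
        qed (use et t' in \<open>auto simp: vertex_point_apply split: if_splits\<close>)
      qed
      with bnd b1 t' consider "1 - t < coord e x" | "0 < coord e x" "0 < coord b x"
        | "coord e x < 1 - t" "coord e x + coord b x < 1" by linarith
      then show "x \<in> A \<union> B" using xP by cases (simp_all add: A_def B_def)
    qed
    have "Pt (vertex_point e) \<noteq> Pt (vertex_point b)"
      using V(5) by (metis fpoint.inject(1) vertex_point_apply zero_neq_one)
    then show "Pt (vertex_point e) \<in> K - {Pt (vertex_point b)}" using verts V by simp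
    show "Pt (vertex_point e) \<in> A"
      using subsetD[OF K verts[of e]] V t' deg by (simp add: A_def vertex_point_apply)
    have "Pt (vertex_point a) \<noteq> Pt (vertex_point b)"
      using deg(2) by (metis fpoint.inject(1) vertex_point_apply zero_neq_one)
    then show "Pt (vertex_point a) \<in> K - {Pt (vertex_point b)}" using verts V by simp
    show "Pt (vertex_point a) \<in> B"
      using subsetD[OF K verts[of a]] V t' deg by (simp add: B_def vertex_point_apply)
  qed
qed

section \<open>A colouring from the removal of two vertices\<close>
text \<open>
  A finite set meets only finitely many of the edges \<open>\<rho> n\<close>--\<open>\<sigma> n\<close>, so it cannot separate tails
  of the two rays.
\<close>
lemma rays_matched_imp_ray_equiv:
  assumes "\<rho> \<in> rays V E" "\<sigma> \<in> rays V E" "\<And>n. (\<rho> n, \<sigma> n) \<in> E"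
  shows "(\<rho>, \<sigma>) \<in> ray_equiv V E"
proof -
  have "\<exists>C \<in> components_minus V E S. has_tail_in \<rho> C \<and> has_tail_in \<sigma> C"
    if S: "finite S" for S
  proof -
    obtain C m where C: "C \<in> components_minus V E S" and m: "\<rho> ` {m..} \<subseteq> C"
      using ray_tail_component[OF assms(1) S] unfolding has_tail_in_def by blast
    obtain D k where D: "D \<in> components_minus V E S" and k: "\<sigma> ` {k..} \<subseteq> D"
      using ray_tail_component[OF assms(2) S] unfolding has_tail_in_def by blast
    have out: "\<sigma> n \<in> V - S" if "n \<ge> k" for n
      using component_subset[OF D] k that by blast
    have "\<sigma> n \<in> C" if "n \<ge> max m k" for n
      using component_closed[OF C _ assms(3)[of n] out] m that by auto
    then have "\<sigma> ` {max m k..} \<subseteq> C" by auto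
    with C m show ?thesis unfolding has_tail_in_def by blast
  qed
  with assms(1,2) show ?thesis by (auto simp: ray_equiv_def)
qed

lemma ray_converges_to_end:
  assumes G: "simple_graph V E" and "\<rho> \<in> \<omega>"
    and U: "openin (freudenthal V E) U" "End \<omega> \<in> U"
  shows "\<exists>N. \<forall>n \<ge> N. Pt (vertex_point (\<rho> n)) \<in> U"
proof -
  obtain S C \<epsilon> where C: "C \<in> components_minus V E S" "end_lives_in \<omega> C"
    and nb: "end_nbhd V E S C \<epsilon> \<subseteq> U"
    using U unfolding openin_freudenthal[OF G] freudenthal_open_def by blast
  obtain N where N: "\<rho> ` {N..} \<subseteq> C"
    using C(2) assms(2) unfolding end_lives_in_def has_tail_in_def by blast
  have "Pt (vertex_point (\<rho> n)) \<in> U" if "n \<ge> N" for n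
  proof -
    have "\<rho> n \<in> C" using N that by auto
    then show ?thesis using nb unfolding end_nbhd_def one_complex_def by blast
  qed
  then show ?thesis by blast
qed

text \<open>
  The circle without \<open>p\<close> and \<open>q\<close> falls into two relatively open parts, and the colour of a vertex
  tells its part. A whole edge lies in the circle as soon as its midpoint does, and its connectedness
  makes its endpoints agree; a ray agrees from some point on with its end. Conversely each point of
  the punctured circle agrees with some vertex other than \<open>p\<close> and \<open>q\<close>, hence both colours occur on
  vertices. For an inner point of an edge this uses that \<open>p\<close> and \<open>q\<close> are not adjacent.
\<close>
lemma hamilton_circle_minus_two_vertices_colouring:
  assumes G: "simple_graph V E" and H: "hamilton_circle V E K"
    and pq: "p \<in> V" "q \<in> V" "p \<noteq> q" "(p, q) \<notin> E"
  obtains P :: "'a \<Rightarrow> bool" where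
    "\<And>u v. (u, v) \<in> E \<Longrightarrow> u \<notin> {p, q} \<Longrightarrow> v \<notin> {p, q} \<Longrightarrow>
        Pt (edge_point u v (1/2)) \<in> K \<Longrightarrow> P u \<longleftrightarrow> P v"
    and "\<And>\<omega>. \<omega> \<in> graph_ends V E \<Longrightarrow>
        \<exists>c. \<forall>\<rho> \<in> \<omega>. \<exists>N. \<forall>n \<ge> N. \<rho> n \<notin> {p, q} \<longrightarrow> (P (\<rho> n) \<longleftrightarrow> c)"
    and "\<exists>u \<in> V - {p, q}. \<exists>v \<in> V - {p, q}. P u \<and> \<not> P v"
proof -
  let ?X = "freudenthal V E"
  let ?v = "\<lambda>u. Pt (vertex_point u)"
  have circ: "circle_in ?X K" and verts: "\<And>v. v \<in> V \<Longrightarrow> ?v v \<in> K"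
    and ends: "\<And>\<omega>. \<omega> \<in> graph_ends V E \<Longrightarrow> End \<omega> \<in> K"
    using H by (auto simp: hamilton_circle_def)
  have K: "K \<subseteq> freudenthal_points V E"
    using circ by (auto simp: circle_in_def topspace_freudenthal[OF G])
  have sym: "sym E" and EV: "E \<subseteq> V \<times> V" and irr: "irrefl E"
    using G by (auto simp: simple_graph_def)
  define T where "T = K - {?v p, ?v q}"
  have vT: "?v u \<in> T \<longleftrightarrow> u \<notin> {p, q}" if "u \<in> V" for u
    using verts[OF that] by (auto simp: T_def)
  have "\<not> connectedin ?X T"
    unfolding T_def using pq verts by (intro circle_in_minus_two_points_disconnected[OF circ]) auto
  moreover have TX: "T \<subseteq> topspace ?X" using K by (auto simp: T_def topspace_freudenthal[OF G])
  ultimately obtain A B where AB: "openin ?X A" "openin ?X B" "T \<subseteq> A \<union> B" "A \<inter> B \<inter> T = {}"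
    "A \<inter> T \<noteq> {}" "B \<inter> T \<noteq> {}"
    unfolding connectedin by auto
  have same: "x \<in> A \<longleftrightarrow> y \<in> A" if D: "connectedin ?X D" "D \<subseteq> T" "x \<in> D" "y \<in> D" for D x y
  proof -
    have "D \<subseteq> A \<union> B" "A \<inter> B \<inter> D = {}" using AB(3,4) D(2) by blast+
    then have "A \<inter> D = {} \<or> B \<inter> D = {}"
      using D(1) AB(1,2) unfolding connectedin by metis
    then show ?thesis using \<open>D \<subseteq> A \<union> B\<close> D(3,4) by blast
  qed
  have segment: "?v u \<in> A \<longleftrightarrow> Pt (edge_point u v s) \<in> A"
    if "(u, v) \<in> E" "u \<notin> {p, q}" "0 < r" "r < 1" "Pt (edge_point u v r) \<in> K"
      "0 \<le> s" "s \<le> 1" "s = 1 \<longrightarrow> v \<notin> {p, q}" for u v r s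
  proof (rule same)
    have "u \<noteq> v" using that(1) irr by (auto simp: irrefl_def)
    have "Pt (edge_point u v t) \<in> T" if t: "t \<in> {0..s}" for t
    proof -
      have "Pt (edge_point u v t) \<in> K"
        using circle_contains_edge[OF G circ verts
            \<open>(u, v) \<in> E\<close> \<open>0 < r\<close> \<open>r < 1\<close> \<open>Pt (edge_point u v r) \<in> K\<close>] t \<open>s \<le> 1\<close> by auto
      moreover have "edge_point u v t \<noteq> vertex_point z" if z: "z \<in> {p, q}" for z
      proof
        assume eq: "edge_point u v t = vertex_point z"
        have "z \<noteq> u" using z \<open>u \<notin> {p, q}\<close> by blast
        then have "edge_point u v t z = t * vertex_point v z"
          by (simp add: edge_point_def vertex_point_apply)
        then have "t = 1 \<and> z = v"
          using eq by (auto simp: vertex_point_apply split: if_splits)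
        with t z \<open>s \<le> 1\<close> \<open>s = 1 \<longrightarrow> v \<notin> {p, q}\<close> show False by auto
      qed
      ultimately show ?thesis by (auto simp: T_def)
    qed
    then show "(\<lambda>t. Pt (edge_point u v t)) ` {0..s} \<subseteq> T" by blast
    show "?v u \<in> (\<lambda>t. Pt (edge_point u v t)) ` {0..s}"
      using \<open>0 \<le> s\<close> by (intro image_eqI[of _ _ 0]) (auto simp: edge_point_0)
    show "Pt (edge_point u v s) \<in> (\<lambda>t. Pt (edge_point u v t)) ` {0..s}"
      using \<open>0 \<le> s\<close> by auto
  qed (use that G in \<open>auto intro: connectedin_edge_segment\<close>)
  define P where "P = (\<lambda>u. ?v u \<in> A)"
  have limit: "\<exists>N. \<forall>n \<ge> N. \<rho> n \<notin> {p, q} \<longrightarrow> (P (\<rho> n) \<longleftrightarrow> End \<omega> \<in> A)"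
    if \<omega>: "\<omega> \<in> graph_ends V E" "\<rho> \<in> \<omega>" for \<omega> \<rho>
  proof -
    have "\<rho> \<in> rays V E"
      using \<omega> equiv_class_eq_iff[OF equiv_ray_equiv[OF sym]] unfolding graph_ends_def quotient_def
      by (auto simp: ray_equiv_def)
    then have \<rho>V: "\<rho> n \<in> V" for n by (auto simp: rays_def)
    have "End \<omega> \<in> T" using ends[OF \<omega>(1)] by (auto simp: T_def)
    then consider "End \<omega> \<in> A" | "End \<omega> \<notin> A" "End \<omega> \<in> B" using AB(3) by blast
    then show ?thesis
    proof cases
      case 1
      then show ?thesis
        using ray_converges_to_end[OF G \<omega>(2) AB(1)] unfolding P_def by blast
    next
      case 2
      then obtain N where "\<forall>n\<ge>N. ?v (\<rho> n) \<in> B"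
        using ray_converges_to_end[OF G \<omega>(2) AB(2)] by blast
      with 2 show ?thesis using AB(4) vT[OF \<rho>V] unfolding P_def by blast
    qed
  qed
  have near: "\<exists>u \<in> V - {p, q}. P u \<longleftrightarrow> x \<in> A" if "x \<in> T" for x
  proof -
    have "x \<in> freudenthal_points V E" "x \<in> K" using that K by (auto simp: T_def)
    with G show ?thesis
    proof (cases rule: freudenthal_pointsE)
      case (vertex u)
      then show ?thesis using that vT unfolding P_def by blast
    next
      case (edge u v t)
      have E: "(v, u) \<in> E" "u \<in> V" "v \<in> V" using edge(1) sym EV by (auto simp: sym_def)
      show ?thesis
      proof (cases "u \<in> {p, q}")
        case True
        then have "v \<notin> {p, q}" using edge(1) pq sym irr by (auto simp: sym_def irrefl_def)
        moreover have x: "x = Pt (edge_point v u (1 - t))"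
          using edge by (simp add: edge_point_commute[of v u])
        ultimately have "?v v \<in> A \<longleftrightarrow> x \<in> A"
          using segment[OF E(1), of "1 - t" "1 - t"] edge(2,3) \<open>x \<in> K\<close> by auto
        with \<open>v \<notin> {p, q}\<close> E show ?thesis unfolding P_def by blast
      next
        case False
        then have "?v u \<in> A \<longleftrightarrow> x \<in> A"
          using segment[OF edge(1), of t t] edge(2-) \<open>x \<in> K\<close> by auto
        with False E show ?thesis unfolding P_def by blast
      qed
    next
      case (ending \<omega>)
      then obtain \<rho> where \<rho>: "\<rho> \<in> rays V E" "\<omega> = ray_equiv V E `` {\<rho>}"
        by (auto simp: graph_ends_def quotient_def)
      then have "\<rho> \<in> \<omega>" using equiv_class_self[OF equiv_ray_equiv[OF sym]] by blast
      then obtain N where N: "\<forall>n \<ge> N. \<rho> n \<notin> {p, q} \<longrightarrow> (P (\<rho> n) \<longleftrightarrow> x \<in> A)"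
        using limit ending by blast
      have "infinite (\<rho> ` {N..})"
        using \<rho>(1) by (auto simp: rays_def finite_image_iff inj_on_def infinite_Ici)
      then have "\<not> \<rho> ` {N..} \<subseteq> {p, q}" using finite_subset by blast
      then obtain n where "n \<ge> N" "\<rho> n \<notin> {p, q}" by blast
      moreover have "\<rho> n \<in> V" using \<rho>(1) by (auto simp: rays_def)
      ultimately show ?thesis using N by blast
    qed
  qed
  show thesis
  proof
    show "P u \<longleftrightarrow> P v" if "(u, v) \<in> E" "u \<notin> {p, q}" "v \<notin> {p, q}"
      "Pt (edge_point u v (1/2)) \<in> K" for u v
      using segment[of u v "1/2" 1] that unfolding P_def by (simp add: edge_point_1)
    show "\<exists>c. \<forall>\<rho> \<in> \<omega>. \<exists>N. \<forall>n \<ge> N. \<rho> n \<notin> {p, q} \<longrightarrow> (P (\<rho> n) \<longleftrightarrow> c)"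
      if "\<omega> \<in> graph_ends V E" for \<omega>
      using limit[OF that] by blast
    obtain x y where "x \<in> T" "x \<in> A" "y \<in> T" "y \<notin> A" using AB by blast
    with near[of x] near[of y] show "\<exists>u \<in> V - {p, q}. \<exists>v \<in> V - {p, q}. P u \<and> \<not> P v" by blast
  qed
qed

section \<open>Cycles and balls\<close>
lemma is_cycleI:
  assumes "length c \<ge> 3" "distinct c" "successively (\<lambda>x y. (x, y) \<in> E) c" "(last c, hd c) \<in> E"
  shows "is_cycle E c"
  unfolding is_cycle_def
proof (intro conjI allI impI)
  fix i assume i: "i < length c"
  show "(c ! i, c ! (Suc i mod length c)) \<in> E"
  proof (cases "Suc i < length c")
    case True
    then show ?thesis using successively_nth[OF assms(3)] by simp
  next
    case False
    then have "Suc i = length c" using i by simp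
    moreover have "c \<noteq> []" using assms(1) by auto
    moreover have "i = length c - 1" using \<open>Suc i = length c\<close> by simp
    ultimately show ?thesis using assms(4) by (simp add: last_conv_nth hd_conv_nth)
  qed
qed (use assms in auto)

lemma hamiltonian_inducedI:
  assumes "is_cycle E c" "set c = W"
  shows "hamiltonian W (induced_edges E W)"
proof -
  have "c ! i \<in> W" "c ! (Suc i mod length c) \<in> W" if "i < length c" for i
    using assms(2) that by (auto intro!: nth_mem mod_less_divisor)
  then have "is_cycle (induced_edges E W) c"
    using assms(1) unfolding is_cycle_def induced_edges_def by blast
  with assms(2) show ?thesis by (auto simp: hamiltonian_def)
qed

text \<open>
  The infimum defining the distance is attained, because \<open>enat\<close> is well-ordered.
\<close>
lemma mem_ball_verts:
  "v \<in> ball_verts V E u r \<longleftrightarrow> v \<in> V \<and> (\<exists>n\<le>r. (u, v) \<in> E ^^ n)"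
proof -
  have "graph_dist E u v \<le> enat r \<longleftrightarrow> (\<exists>n\<le>r. (u, v) \<in> E ^^ n)"
  proof
    assume le: "graph_dist E u v \<le> enat r"
    let ?D = "enat ` {n. (u, v) \<in> E ^^ n}"
    have "?D \<noteq> {}"
    proof
      assume "?D = {}"
      then have "graph_dist E u v = \<infinity>" by (simp only: graph_dist_def Inf_empty top_enat_def)
      with le show False by simp
    qed
    then have "Inf ?D \<in> ?D" unfolding Inf_enat_def by (auto intro: LeastI)
    then show "\<exists>n\<le>r. (u, v) \<in> E ^^ n" using le by (auto simp: graph_dist_def)
  next
    assume "\<exists>n\<le>r. (u, v) \<in> E ^^ n"
    then obtain n where "n \<le> r" "(u, v) \<in> E ^^ n" by blast
    then show "graph_dist E u v \<le> enat r"
      unfolding graph_dist_def by (intro INF_lower2[of n]) auto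
  qed
  then show ?thesis by (auto simp: ball_verts_def)
qed

section \<open>Four parallel double rays with ears\<close>

text \<open>
  The vertices are coded as natural numbers by the injection \<open>to_nat\<close>; the third component tells
  the vertices of the columns from the ears.
\<close>
definition strand :: "int \<Rightarrow> nat \<Rightarrow> nat" where "strand i j = to_nat (i, j, False)"
definition ear :: "int \<Rightarrow> nat \<Rightarrow> nat" where "ear i j = to_nat (i, j, True)"

lemma strand_ear_inject [simp]:
  "strand i j = strand k l \<longleftrightarrow> i = k \<and> j = l"
  "ear i j = ear k l \<longleftrightarrow> i = k \<and> j = l"
  "strand i j \<noteq> ear k l" "ear k l \<noteq> strand i j"
  by (auto simp: strand_def ear_def)

definition cable_verts :: "nat set" where
  "cable_verts = {strand i j | i j. j < 4} \<union> {ear i j | i j. j < 4}"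

definition cable_edges :: "nat rel" where
  "cable_edges = {(strand i j, strand k l) | i j k l. j < 4 \<and> l < 4 \<and> \<bar>i - k\<bar> \<le> 1 \<and> (i, j) \<noteq> (k, l)}
     \<union> {(strand k j, ear i j) | i j k. j < 4 \<and> (k = i \<or> k = i + 1)}
     \<union> {(ear i j, strand k j) | i j k. j < 4 \<and> (k = i \<or> k = i + 1)}"

lemma cable_verts_simps [simp]:
  "strand i j \<in> cable_verts \<longleftrightarrow> j < 4" "ear i j \<in> cable_verts \<longleftrightarrow> j < 4"
  by (auto simp: cable_verts_def)

lemma cable_edges_simps [simp]:
  "(strand i j, strand k l) \<in> cable_edges \<longleftrightarrow> j < 4 \<and> l < 4 \<and> \<bar>i - k\<bar> \<le> 1 \<and> (i, j) \<noteq> (k, l)"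
  "(strand k l, ear i j) \<in> cable_edges \<longleftrightarrow> j < 4 \<and> l = j \<and> (k = i \<or> k = i + 1)"
  "(ear i j, strand k l) \<in> cable_edges \<longleftrightarrow> j < 4 \<and> l = j \<and> (k = i \<or> k = i + 1)"
  "(ear i j, ear k l) \<notin> cable_edges"
  by (auto simp: cable_edges_def)

lemma cable_vertsE:
  assumes "x \<in> cable_verts"
  obtains (strand) i j where "x = strand i j" "j < 4" | (ear) i j where "x = ear i j" "j < 4"
  using assms by (auto simp: cable_verts_def)

lemma ear_neighbours: "j < 4 \<Longrightarrow> cable_edges `` {ear i j} = {strand i j, strand (i + 1) j}"
  by (auto simp: cable_edges_def)

lemma cable_edges_subset: "cable_edges \<subseteq> cable_verts \<times> cable_verts"
  by (auto simp: cable_edges_def)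

lemma sym_cable_edges: "sym cable_edges"
  unfolding sym_def cable_edges_def by (auto simp: abs_minus_commute)

lemma simple_cable: "simple_graph cable_verts cable_edges"
  using cable_edges_subset sym_cable_edges
  by (auto simp: simple_graph_def irrefl_def cable_edges_def)

lemma infinite_cable_verts: "infinite cable_verts"
proof -
  have "inj (\<lambda>i. strand i 0)" by (auto simp: inj_def)
  then have "infinite (range (\<lambda>i. strand i 0))"
    using finite_imageD infinite_UNIV_int by blast
  moreover have "range (\<lambda>i. strand i 0) \<subseteq> cable_verts" by auto
  ultimately show ?thesis by (metis finite_subset)
qed

lemma locally_finite_cable: "locally_finite cable_verts cable_edges"
  unfolding locally_finite_def
proof
  fix x assume "x \<in> cable_verts"
  then show "finite (cable_edges `` {x})"
  proof (cases rule: cable_vertsE)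
    case (strand i j)
    have "cable_edges `` {x} \<subseteq>
        case_prod strand ` ({i - 1..i + 1} \<times> {..<4}) \<union> (\<lambda>k. ear k j) ` {i - 1..i}"
    proof
      fix y assume y: "y \<in> cable_edges `` {x}"
      then have "y \<in> cable_verts" using cable_edges_subset by blast
      then show "y \<in> case_prod strand ` ({i - 1..i + 1} \<times> {..<4}) \<union> (\<lambda>k. ear k j) ` {i - 1..i}"
        using y strand by (cases rule: cable_vertsE) (auto simp: image_iff)
    qed
    then show ?thesis by (rule finite_subset) auto
  next
    case (ear i j)
    have "cable_edges `` {x} \<subseteq> {strand i j, strand (i + 1) j}"
      using ear by (auto simp: cable_edges_def)
    then show ?thesis by (rule finite_subset) auto
  qed
qed

subsection \<open>Balls\<close>

text \<open>
  Any step may change rows, and the case \<open>k = i\<close>, \<open>j \<noteq> l\<close> is the reason for \<open>1 \<le> n\<close>.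
\<close>
lemma strand_strand_reachable:
  assumes "j < 4" "l < 4" "1 \<le> n" "\<bar>k - i\<bar> \<le> int n"
  shows "\<exists>m\<le>n. (strand i j, strand k l) \<in> cable_edges ^^ m"
  using assms(3,4)
proof (induction n arbitrary: k rule: nat_induct_at_least)
  case base
  show ?case
  proof (cases "(k, l) = (i, j)")
    case True
    then show ?thesis by (intro exI[of _ 0]) auto
  next
    case False
    then show ?thesis using base assms by (intro exI[of _ 1]) auto
  qed
next
  case (Suc n)
  show ?case
  proof (cases "\<bar>k - i\<bar> \<le> int n")
    case True
    then show ?thesis using Suc.IH[of k] by (meson le_SucI)
  next
    case False
    \<comment> \<open>The neighbouring column on the side of the starting point.\<close>
    define k' where "k' = (if k > i then k - 1 else k + 1)"
    have "\<bar>k' - i\<bar> \<le> int n" using False Suc.prems by (auto simp: k'_def)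
    then obtain m where "m \<le> n" "(strand i j, strand k' l) \<in> cable_edges ^^ m"
      using Suc.IH[of k'] by blast
    moreover have "(strand k' l, strand k l) \<in> cable_edges" using assms by (auto simp: k'_def)
    ultimately show ?thesis by (intro exI[of _ "Suc m"]) auto
  qed
qed

text \<open>
  In \<open>n\<close> steps only the columns at distance at most \<open>n\<close> are reached. For an ear both of the
  columns that it spans obey this bound; that stronger claim is what the induction needs, since an
  ear is left to either side.
\<close>
lemma reachable_from_strand:
  assumes "(strand i j, x) \<in> cable_edges ^^ n"
  shows "x = strand k l \<Longrightarrow> \<bar>k - i\<bar> \<le> int n"
    and "x = ear k l \<Longrightarrow> i - int n \<le> k \<and> k < i + int n"
proof -
  have "(\<forall>k l. x = strand k l \<longrightarrow> \<bar>k - i\<bar> \<le> int n) \<and>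
    (\<forall>k l. x = ear k l \<longrightarrow> i - int n \<le> k \<and> k < i + int n)"
    using assms
  proof (induction n arbitrary: x)
    case (Suc n)
    then obtain y where y: "(strand i j, y) \<in> cable_edges ^^ n" "(y, x) \<in> cable_edges" by auto
    then have "y \<in> cable_verts" using cable_edges_subset by blast
    then show ?case using Suc.IH[OF y(1)] y(2) by (cases rule: cable_vertsE) auto
  qed auto
  then show "x = strand k l \<Longrightarrow> \<bar>k - i\<bar> \<le> int n"
    and "x = ear k l \<Longrightarrow> i - int n \<le> k \<and> k < i + int n" by blast+
qed

lemma connected_cable: "graph_connected cable_verts cable_edges"
proof -
  have mm: "(strand i j, strand k l) \<in> cable_edges\<^sup>*" if "j < 4" "l < 4" for i j k l
    using strand_strand_reachable[OF that, of "Suc (nat \<bar>k - i\<bar>)" k i] relpow_imp_rtrancl by fastforce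
  have "\<exists>i. (x, strand i 0) \<in> cable_edges\<^sup>*" if x: "x \<in> cable_verts" for x
    using x
  proof (cases rule: cable_vertsE)
    case (ear i j)
    then have "(x, strand i j) \<in> cable_edges" by simp
    with ear show ?thesis using mm[of j 0 i i] by (meson converse_rtrancl_into_rtrancl zero_less_numeral)
  qed (use mm in auto)
  then have to: "(x, strand 0 0) \<in> cable_edges\<^sup>*" if "x \<in> cable_verts" for x
    using that mm[of 0 0] by (meson rtrancl_trans zero_less_numeral)
  then have "(strand 0 0, x) \<in> cable_edges\<^sup>*" if "x \<in> cable_verts" for x
    using that sym_rtrancl[OF sym_cable_edges] by (meson symE)
  with to show ?thesis unfolding graph_connected_def by (meson rtrancl_trans)
qed

text \<open>
  A row from column \<open>a\<close> to column \<open>a + n\<close>, with a detour through every ear that belongs to \<open>W\<close>. An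
  ear outside \<open>W\<close> is bypassed along the row edge below it.
\<close>
fun row_path :: "nat set \<Rightarrow> int \<Rightarrow> nat \<Rightarrow> nat \<Rightarrow> nat list" where
  "row_path W a j 0 = [strand a j]"
| "row_path W a j (Suc n) = row_path W a j n @
     (if ear (a + int n) j \<in> W then [ear (a + int n) j] else []) @ [strand (a + int n + 1) j]"

lemma row_path_ends [simp]:
  "row_path W a j n \<noteq> []" "hd (row_path W a j n) = strand a j"
  "last (row_path W a j n) = strand (a + int n) j"
proof -
  have ne: "row_path W a j n \<noteq> []" for n by (cases n) auto
  show "row_path W a j n \<noteq> []" by (rule ne)
  show "hd (row_path W a j n) = strand a j" by (induction n) (auto simp: hd_append ne)
  show "last (row_path W a j n) = strand (a + int n) j" by (cases n) (auto simp: ac_simps)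
qed

lemma set_row_path:
  "set (row_path W a j n) = {strand k j | k. a \<le> k \<and> k \<le> a + int n}
     \<union> W \<inter> {ear k j | k. a \<le> k \<and> k < a + int n}"
proof (induction n)
  case (Suc n)
  have "x \<le> a + int (Suc n) \<longleftrightarrow> x \<le> a + int n \<or> x = a + int n + 1"
    "x < a + int (Suc n) \<longleftrightarrow> x < a + int n \<or> x = a + int n" for x by auto
  then show ?case using Suc by auto
qed auto

lemma distinct_row_path: "distinct (row_path W a j n)"
  by (induction n) (auto simp: set_row_path)

lemma successively_row_path:
  "j < 4 \<Longrightarrow> successively (\<lambda>x y. (x, y) \<in> cable_edges) (row_path W a j n)"
  by (induction n) (auto simp: successively_append_iff)

text \<open>
  The cycle follows rows \<open>0\<close> and \<open>2\<close> to the right and rows \<open>1\<close> and \<open>3\<close> to the left. It closes up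
  because the number of rows is even. The set of ears is arbitrary because a ball omits some of
  them in general: the ball of radius 1 around \<open>strand i j\<close> contains only ears of row \<open>j\<close>.
\<close>
lemma hamiltonian_cable_segment:
  assumes W: "W \<subseteq> cable_verts"
    and strands: "\<And>k j. j < 4 \<Longrightarrow> strand k j \<in> W \<longleftrightarrow> a \<le> k \<and> k \<le> a + int n"
    and ears: "\<And>k j. ear k j \<in> W \<Longrightarrow> a \<le> k \<and> k < a + int n"
  shows "hamiltonian W (induced_edges cable_edges W)"
proof (rule hamiltonian_inducedI)
  let ?r = "\<lambda>j. row_path W a j n"
  let ?c = "?r 0 @ rev (?r 1) @ ?r 2 @ rev (?r 3)"
  have rev_succ: "successively (\<lambda>x y. (y, x) \<in> cable_edges) (?r j)" if "j < 4" for j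
  proof -
    have "(\<lambda>x y. (y, x) \<in> cable_edges) = (\<lambda>x y. (x, y) \<in> cable_edges)"
      using sym_cable_edges by (auto simp: sym_def fun_eq_iff)
    then show ?thesis using successively_row_path[OF that] by presburger
  qed
  show "is_cycle cable_edges ?c"
  proof (rule is_cycleI)
    have "length (?r j) \<ge> 1" for j by (simp add: Suc_leI)
    from add_mono[OF add_mono[OF this[of 0] this[of 1]] this[of 2]] show "length ?c \<ge> 3" by simp
    show "distinct ?c" by (auto simp: distinct_row_path set_row_path)
    show "successively (\<lambda>x y. (x, y) \<in> cable_edges) ?c"
      by (auto simp: successively_append_iff successively_row_path rev_succ hd_rev last_rev hd_append)
    show "(last ?c, hd ?c) \<in> cable_edges" by (simp add: last_rev)
  qed
  show "set ?c = W"
  proof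
    show "set ?c \<subseteq> W" using strands by (auto simp: set_row_path)
    show "W \<subseteq> set ?c"
    proof
      fix x assume "x \<in> W"
      have four: "j = 0 \<or> j = 1 \<or> j = 2 \<or> j = 3" if "j < 4" for j :: nat using that by auto
      from \<open>x \<in> W\<close> W have "x \<in> cable_verts" by blast
      then show "x \<in> set ?c"
      proof (cases rule: cable_vertsE)
        case (strand k j)
        with \<open>x \<in> W\<close> strands have "x \<in> set (?r j)" by (auto simp: set_row_path)
        with four[OF strand(2)] show ?thesis by auto
      next
        case (ear k j)
        with \<open>x \<in> W\<close> ears have "x \<in> set (?r j)" by (auto simp: set_row_path)
        with four[OF ear(2)] show ?thesis by auto
      qed
    qed
  qed
qed

lemma hamiltonian_ball_strand:
  assumes "j < 4" "1 \<le> r"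
  shows "hamiltonian (ball_verts cable_verts cable_edges (strand i j) r)
    (induced_edges cable_edges (ball_verts cable_verts cable_edges (strand i j) r))"
proof (rule hamiltonian_cable_segment[where a = "i - int r" and n = "2 * r"])
  let ?W = "ball_verts cable_verts cable_edges (strand i j) r"
  show "?W \<subseteq> cable_verts" by (auto simp: ball_verts_def)
  show "strand k l \<in> ?W \<longleftrightarrow> i - int r \<le> k \<and> k \<le> i - int r + int (2 * r)" if "l < 4" for k l
  proof
    assume "strand k l \<in> ?W"
    then show "i - int r \<le> k \<and> k \<le> i - int r + int (2 * r)"
      using reachable_from_strand(1) by (fastforce simp: mem_ball_verts)
  next
    assume "i - int r \<le> k \<and> k \<le> i - int r + int (2 * r)"
    then have "\<bar>k - i\<bar> \<le> int r" by auto
    then show "strand k l \<in> ?W"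
      using strand_strand_reachable[OF assms(1) that assms(2)] that by (auto simp: mem_ball_verts)
  qed
  show "i - int r \<le> k \<and> k < i - int r + int (2 * r)" if "ear k l \<in> ?W" for k l
    using that reachable_from_strand(2) by (fastforce simp: mem_ball_verts)
qed

text \<open>
  The first step leads to one of the two columns spanned by the ear, so one step is lost in either
  direction compared with \<open>reachable_from_strand\<close>, and the range is not symmetric about \<open>i\<close>.
\<close>
lemma reachable_from_ear:
  assumes "(ear i j, x) \<in> cable_edges ^^ n" "n \<ge> 1"
  shows "x = strand k l \<Longrightarrow> i - int (n - 1) \<le> k \<and> k \<le> i + int n"
    and "x = ear k l \<Longrightarrow> i - int (n - 1) \<le> k \<and> k < i + int n"
proof -
  obtain m where m: "n = Suc m" using assms(2) by (cases n) auto
  then obtain y where y: "(ear i j, y) \<in> cable_edges" "(y, x) \<in> cable_edges ^^ m"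
    using assms(1) relpow_Suc_D2 by metis
  then obtain i' where i': "y = strand i' j" "i' = i \<or> i' = i + 1"
    by (auto simp: cable_edges_def)
  show "i - int (n - 1) \<le> k \<and> k \<le> i + int n" if "x = strand k l"
    using reachable_from_strand(1)[OF y(2)[unfolded i'(1)] that] i'(2) m by auto
  show "i - int (n - 1) \<le> k \<and> k < i + int n" if "x = ear k l"
    using reachable_from_strand(2)[OF y(2)[unfolded i'(1)] that] i'(2) m by auto
qed

text \<open>
  For \<open>r = 1\<close> the ball is the triangle formed by the ear and its row edge. From \<open>r = 2\<close> on, the
  columns in the ball are full, since one step suffices to change rows.
\<close>
lemma hamiltonian_ball_ear:
  assumes j: "j < 4" and r: "1 \<le> r"
  shows "hamiltonian (ball_verts cable_verts cable_edges (ear i j) r)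
    (induced_edges cable_edges (ball_verts cable_verts cable_edges (ear i j) r))"
proof (cases "r = 1")
  case True
  let ?c = "[ear i j, strand i j, strand (i + 1) j]"
  have "ball_verts cable_verts cable_edges (ear i j) 1 = set ?c"
  proof -
    have "(\<exists>n\<le>1. Q n) \<longleftrightarrow> Q 0 \<or> Q 1" for Q :: "nat \<Rightarrow> bool"
      by (auto simp: le_Suc_eq)
    then have "ball_verts cable_verts cable_edges (ear i j) 1 =
        cable_verts \<inter> insert (ear i j) (cable_edges `` {ear i j})"
      by (simp only: set_eq_iff mem_ball_verts relpow_1 relpow.simps(1)) auto
    then show ?thesis using ear_neighbours[OF j] j by simp
  qed
  moreover have "is_cycle cable_edges ?c" using j by (intro is_cycleI) auto
  ultimately show ?thesis using True hamiltonian_inducedI[of cable_edges ?c] by simp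
next
  case False
  with r have r2: "r \<ge> 2" by simp
  let ?W = "ball_verts cable_verts cable_edges (ear i j) r"
  show ?thesis
  proof (rule hamiltonian_cable_segment[where a = "i - int (r - 1)" and n = "2 * r - 1"])
    show "?W \<subseteq> cable_verts" by (auto simp: ball_verts_def)
    have len: "i - int (r - 1) + int (2 * r - 1) = i + int r" using r2 by simp
    show "strand k l \<in> ?W \<longleftrightarrow> i - int (r - 1) \<le> k \<and> k \<le> i - int (r - 1) + int (2 * r - 1)"
      if l: "l < 4" for k l
      unfolding len
    proof
      assume "strand k l \<in> ?W"
      then obtain n where n: "n \<le> r" "(ear i j, strand k l) \<in> cable_edges ^^ n"
        by (auto simp: mem_ball_verts)
      then have "n \<ge> 1" by (cases n) auto
      then show "i - int (r - 1) \<le> k \<and> k \<le> i + int r"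
        using reachable_from_ear(1)[OF n(2) _ refl] n(1) by auto
    next
      assume k: "i - int (r - 1) \<le> k \<and> k \<le> i + int r"
      \<comment> \<open>Start towards the endpoint of the ear that is nearer to column \<open>k\<close>.\<close>
      define i' where "i' = (if k \<le> i then i else i + 1)"
      have "1 \<le> r - 1" using r2 by linarith
      have "\<bar>k - i'\<bar> \<le> int (r - 1)" using k r2 by (auto simp: i'_def)
      then obtain m where m: "m \<le> r - 1" "(strand i' j, strand k l) \<in> cable_edges ^^ m"
        using strand_strand_reachable[OF j l \<open>1 \<le> r - 1\<close>] by blast
      have "(ear i j, strand i' j) \<in> cable_edges" using j by (simp add: i'_def)
      then have "(ear i j, strand k l) \<in> cable_edges ^^ Suc m" using m(2) by (rule relpow_Suc_I2)
      then show "strand k l \<in> ?W"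
        using m(1) r2 l unfolding mem_ball_verts by (intro conjI exI[of _ "Suc m"]) auto
    qed
    show "i - int (r - 1) \<le> k \<and> k < i - int (r - 1) + int (2 * r - 1)" if e: "ear k l \<in> ?W" for k l
      unfolding len
    proof -
      obtain n where n: "n \<le> r" "(ear i j, ear k l) \<in> cable_edges ^^ n"
        using e by (auto simp: mem_ball_verts)
      show "i - int (r - 1) \<le> k \<and> k < i + int r"
      proof (cases "n = 0")
        case True
        then show ?thesis using n r2 by auto
      next
        case False
        then show ?thesis using reachable_from_ear(2)[OF n(2) _ refl] n(1) by auto
      qed
    qed
  qed
qed

text \<open>
  Bypassing the ears, such rays in two rows are matched by edges within the columns, which is why
  they converge to a common end.
\<close>
lemma row_ray_in_rays:
  assumes "j < 4" "s \<in> {1, -1}"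
  shows "(\<lambda>n. strand (a + s * int n) j) \<in> rays cable_verts cable_edges"
  using assms by (auto simp: rays_def inj_def algebra_simps)

lemma rows_meet_at_an_end:
  assumes s: "s \<in> {1, -1}"
  obtains \<omega> where "\<omega> \<in> graph_ends cable_verts cable_edges"
    and "\<And>j. j < 4 \<Longrightarrow> (\<lambda>n. strand (a + s * int n) j) \<in> \<omega>"
proof
  let ?\<rho> = "\<lambda>j n. strand (a + s * int n) j"
  let ?R = "ray_equiv cable_verts cable_edges"
  note rays = row_ray_in_rays[OF _ s, of _ a]
  show "?R `` {?\<rho> 0} \<in> graph_ends cable_verts cable_edges"
    unfolding graph_ends_def by (intro quotientI rays) simp
  show "?\<rho> j \<in> ?R `` {?\<rho> 0}" if j: "j < 4" for j
  proof (cases "j = 0")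
    case True
    then show ?thesis
      using equiv_class_self[OF equiv_ray_equiv[OF sym_cable_edges] rays[of 0]] by simp
  next
    case False
    then show ?thesis using rays_matched_imp_ray_equiv[OF rays rays, of 0 j] j by simp
  qed
qed

lemma cable_no_hamilton_circle: "\<not> hamilton_circle cable_verts cable_edges K"
proof
  assume H: "hamilton_circle cable_verts cable_edges K"
  note G = simple_cable
  let ?X = "freudenthal cable_verts cable_edges"
  have circ: "circle_in ?X K" and verts: "\<And>v. v \<in> cable_verts \<Longrightarrow> Pt (vertex_point v) \<in> K"
    using H by (auto simp: hamilton_circle_def)
  have ear_in: "Pt (edge_point (ear i j) (strand k j) (1/2)) \<in> K"
    if "j < 4" "k = i \<or> k = i + 1" for i j k
  proof (rule circle_contains_edges_at_degree_two[OF G circ verts])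
    \<comment> \<open>\<open>2 * i + 1 - k\<close> is the other one of the columns \<open>i\<close> and \<open>i + 1\<close>.\<close>
    show "cable_edges `` {ear i j} = {strand k j, strand (2 * i + 1 - k) j}"
      using that by (auto simp: cable_edges_def)
  qed (use that in auto)
  obtain P where adj: "\<And>u v. (u, v) \<in> cable_edges \<Longrightarrow> u \<notin> {ear 0 0, ear 0 1} \<Longrightarrow>
        v \<notin> {ear 0 0, ear 0 1} \<Longrightarrow> Pt (edge_point u v (1/2)) \<in> K \<Longrightarrow> P u \<longleftrightarrow> P v"
    and lim: "\<And>\<omega>. \<omega> \<in> graph_ends cable_verts cable_edges \<Longrightarrow>
        \<exists>c. \<forall>\<rho> \<in> \<omega>. \<exists>N. \<forall>n \<ge> N. \<rho> n \<notin> {ear 0 0, ear 0 1} \<longrightarrow> (P (\<rho> n) \<longleftrightarrow> c)"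
    and nonconst: "\<exists>u \<in> cable_verts - {ear 0 0, ear 0 1}.
        \<exists>v \<in> cable_verts - {ear 0 0, ear 0 1}. P u \<and> \<not> P v"
    by (rule hamilton_circle_minus_two_vertices_colouring[OF G H, of "ear 0 0" "ear 0 1"]) auto
  have ear_col: "P (ear i j) \<longleftrightarrow> P (strand k j)"
    if "j < 4" "k = i \<or> k = i + 1" "ear i j \<notin> {ear 0 0, ear 0 1}" for i j k
    using that by (intro adj ear_in) auto
  have step: "P (strand (i + 1) j) \<longleftrightarrow> P (strand i j)" if "j < 4" "i \<noteq> 0 \<or> j \<noteq> 0 \<and> j \<noteq> 1" for i j
  proof -
    have "ear i j \<notin> {ear 0 0, ear 0 1}" using that(2) by auto
    then show ?thesis using ear_col[of j i i] ear_col[of j "i + 1" i] that(1) by blast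
  qed
  \<comment> \<open>The columns \<open>1, 2, \<dots>\<close> form the right side, the columns \<open>0, -1, \<dots>\<close> the left side;
      the removed ears lie between the two.\<close>
  have side: "\<exists>c. \<forall>j<4. \<forall>n. P (strand (a + s * int n) j) \<longleftrightarrow> c"
    if s: "(a, s) \<in> {(1, 1), (0, -1)}" for a s
  proof -
    have "s \<in> {1, -1}" using s by auto
    then obtain \<omega> where \<omega>: "\<omega> \<in> graph_ends cable_verts cable_edges"
      "\<And>j. j < 4 \<Longrightarrow> (\<lambda>n. strand (a + s * int n) j) \<in> \<omega>"
      by (rule rows_meet_at_an_end[of s a]) blast
    then obtain c where c: "\<And>\<rho>. \<rho> \<in> \<omega> \<Longrightarrow>
        \<exists>N. \<forall>n \<ge> N. \<rho> n \<notin> {ear 0 0, ear 0 1} \<longrightarrow> (P (\<rho> n) \<longleftrightarrow> c)"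
      using lim[OF \<omega>(1)] by blast
    have "P (strand (a + s * int n) j) \<longleftrightarrow> c" if j: "j < 4" for j n
    proof -
      have shift: "P (strand (a + s * int m) j) \<longleftrightarrow> P (strand a j)" for m
      proof (induction m)
        case (Suc m)
        have "P (strand (a + s * int (Suc m)) j) \<longleftrightarrow> P (strand (a + s * int m) j)"
        proof (cases "s = 1")
          case True
          then show ?thesis using s step[OF j, of "1 + int m"] by (auto simp: ac_simps)
        next
          case False
          then have "a + s * int m = - 1 - int m + 1" "a + s * int (Suc m) = - 1 - int m"
            using s by auto
          then show ?thesis using step[OF j, of "- 1 - int m"] by (simp only:) simp
        qed
        with Suc show ?case by simp
      qed simp
      obtain N where "P (strand (a + s * int N) j) \<longleftrightarrow> c" using c[OF \<omega>(2)[OF j]] by auto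
      with shift[of N] shift[of n] show ?thesis by blast
    qed
    then show ?thesis by blast
  qed
  obtain c1 where c1: "\<And>j n. j < 4 \<Longrightarrow> P (strand (1 + 1 * int n) j) \<longleftrightarrow> c1" using side[of 1 1] by blast
  obtain c2 where c2: "\<And>j n. j < 4 \<Longrightarrow> P (strand (0 + -1 * int n) j) \<longleftrightarrow> c2" using side[of 0 "-1"] by blast
  \<comment> \<open>Row 2 has kept its ear between the sides.\<close>
  have "P (strand 1 2) \<longleftrightarrow> P (strand 0 2)" using step[of 2 0] by simp
  then have "c1 = c2" using c1[of 2 0] c2[of 2 0] by simp
  have strands: "P (strand i j) \<longleftrightarrow> c1" if "j < 4" for i j
  proof (cases "i \<ge> 1")
    case True
    then show ?thesis using c1[OF that, of "nat (i - 1)"] by simp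
  next
    case False
    then show ?thesis using c2[OF that, of "nat (- i)"] \<open>c1 = c2\<close> by simp
  qed
  have "P x \<longleftrightarrow> c1" if "x \<in> cable_verts - {ear 0 0, ear 0 1}" for x
  proof -
    from that have "x \<in> cable_verts" by blast
    then show ?thesis
      using strands ear_col that by (cases rule: cable_vertsE) blast+
  qed
  with nonconst show False by blast
qed

theorem proposition3p5:
  shows "\<exists>(V :: nat set) (E :: nat rel).
    simple_graph V E \<and> infinite V \<and> graph_connected V E \<and> locally_finite V E \<and>
    (\<forall>u \<in> V. \<forall>r \<ge> (1::nat).
       hamiltonian (ball_verts V E u r) (induced_edges E (ball_verts V E u r))) \<and>
    \<not> (\<exists>K. hamilton_circle V E K)"
proof (intro exI conjI ballI allI impI)
  show "hamiltonian (ball_verts cable_verts cable_edges u r)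
      (induced_edges cable_edges (ball_verts cable_verts cable_edges u r))"
    if "u \<in> cable_verts" "r \<ge> 1" for u r
    using that hamiltonian_ball_strand hamiltonian_ball_ear by (cases rule: cable_vertsE) auto
  show "\<not> (\<exists>K. hamilton_circle cable_verts cable_edges K)"
    using cable_no_hamilton_circle by blast
qed (use simple_cable infinite_cable_verts connected_cable locally_finite_cable in auto)

end
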